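(* Suppose that $\alpha \in \mathbb{T}^d$ is Diophantine, the phase $\theta \in \mathbb{T}^d$ is arbitrary, the function $f : \mathbb{T}^d \to \mathbb{R}$ is real-analytic, and the coupling constant $c > 0$ is sufficiently small. Let $E^*_c$ be the largest energy in the spectrum of the operator $H_{\mathrm{bg},c}$ on $\ell^2(\mathbb{Z})$ given by $$[H_{\mathrm{bg},c}\psi](n) = \psi(n+1) + \psi(n-1) + c f(\theta + n\alpha)\psi(n).$$ For any sufficiently small $\lambda > 0$, there exists an interval $(E^*_c + \lambda - \varepsilon, E^*_c + \lambda)$, $\varepsilon > 0$, such that for any $E \in (E^*_c + \lambda - \varepsilon, E^*_c + \lambda)$, there exists an $\omega \in \{0, \lambda\}^{\mathbb{Z}}$ such that $E$ is the maximal energy in the spectrum of the operator $$[H_\omega\psi](n) = \psi(n+1) + \psi(n-1) + \big(c f(\theta + n\alpha) + \omega_n\big)\psi(n)$$ on $\ell^2(\mathbb{Z})$, $E$ is an eigenvalue of $H_\omega$, and the corresponding eigenfunction is exponentially decaying and (up to a multiplicative constant) has strictly positive components.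
   Context: $d \in \mathbb{N}$ and $\mathbb{T} = \mathbb{R}/\mathbb{Z}$. $\alpha \in \mathbb{T}^d$ is called Diophantine if there exist constants $\tau, K > 0$ such that $\mathrm{dist}(m \cdot \alpha, \mathbb{Z}) \ge K/|m|^{\tau}$ for every $m \in \mathbb{Z}^d \setminus \{0\}$. Exponentially decaying means that $|\psi(n)| \le A e^{-\kappa |n|}$ for all $n \in \mathbb{Z}$ with some constants $A, \kappa > 0$. "$c > 0$ sufficiently small" means $0 < c < c_1$ for some threshold $c_1 > 0$, and the threshold for $\lambda$ may depend on the preceding data (including $c$). *)

theory Defs
  imports "HOL-Analysis.Analysis"
begin

text \<open>Points of the torus $\mathbb{R}^d/\mathbb{Z}^d$ are represented by lifts in \<open>real ^ 'd\<close>,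
  functions on it by functions on \<open>real ^ 'd\<close> that are periodic under the integer lattice.\<close>

definition int_lattice :: "(real ^ 'd) set" where
  "int_lattice = {m. \<forall>i. m $ i \<in> \<int>}"

definition torus_function :: "(real ^ 'd \<Rightarrow> real) \<Rightarrow> bool" where
  "torus_function f \<longleftrightarrow> (\<forall>x. \<forall>m\<in>int_lattice. f (x + m) = f x)"

definition diophantine :: "real ^ 'd \<Rightarrow> bool" where
  "diophantine \<alpha> \<longleftrightarrow> (\<exists>\<tau> K. \<tau> > 0 \<and> K > 0 \<and>
     (\<forall>m\<in>int_lattice - {0}. infdist (m \<bullet> \<alpha>) \<int> \<ge> K / norm m powr \<tau>))"

text \<open>Around every point, the function is the sum of a power series in the \<open>d\<close> variables; the
  sum runs over multi-indices (\<open>has_sum\<close> over the reals means absolute convergence).\<close>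

definition real_analytic :: "(real ^ 'd \<Rightarrow> real) \<Rightarrow> bool" where
  "real_analytic f \<longleftrightarrow> (\<forall>x\<^sub>0. \<exists>r>0. \<exists>a :: nat ^ 'd \<Rightarrow> real. \<forall>x\<in>ball x\<^sub>0 r.
     ((\<lambda>k. a k * (\<Prod>i\<in>UNIV. (x $ i - x\<^sub>0 $ i) ^ (k $ i))) has_sum f x) UNIV)"

definition l2 :: "(int \<Rightarrow> complex) set" where
  "l2 = {\<psi>. (\<lambda>n. (cmod (\<psi> n))\<^sup>2) summable_on UNIV}"

definition l2_norm :: "(int \<Rightarrow> complex) \<Rightarrow> real" where
  "l2_norm \<psi> = sqrt (\<Sum>\<^sub>\<infinity>n. (cmod (\<psi> n))\<^sup>2)"

text \<open>For a linear operator \<open>A\<close> that maps \<^term>\<open>l2\<close> to itself: \<open>z\<close> is in the resolvent set iff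
  \<open>A - z\<close> is a bijection of \<^term>\<open>l2\<close> whose inverse is bounded.\<close>

definition l2_resolvent_set :: "((int \<Rightarrow> complex) \<Rightarrow> (int \<Rightarrow> complex)) \<Rightarrow> complex set" where
  "l2_resolvent_set A = {z. bij_betw (\<lambda>\<psi> n. A \<psi> n - z * \<psi> n) l2 l2 \<and>
     (\<exists>C. \<forall>\<psi>\<in>l2. l2_norm \<psi> \<le> C * l2_norm (\<lambda>n. A \<psi> n - z * \<psi> n))}"

definition l2_spectrum :: "((int \<Rightarrow> complex) \<Rightarrow> (int \<Rightarrow> complex)) \<Rightarrow> complex set" where
  "l2_spectrum A = - l2_resolvent_set A"

definition largest_energy :: "((int \<Rightarrow> complex) \<Rightarrow> (int \<Rightarrow> complex)) \<Rightarrow> real \<Rightarrow> bool" where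
  "largest_energy A E \<longleftrightarrow>
     complex_of_real E \<in> l2_spectrum A \<and> l2_spectrum A \<subseteq> complex_of_real ` {..E}"

definition eigenfunction ::
    "((int \<Rightarrow> complex) \<Rightarrow> (int \<Rightarrow> complex)) \<Rightarrow> real \<Rightarrow> (int \<Rightarrow> complex) \<Rightarrow> bool" where
  "eigenfunction A E \<psi> \<longleftrightarrow>
     \<psi> \<in> l2 \<and> \<psi> \<noteq> (\<lambda>n. 0) \<and> A \<psi> = (\<lambda>n. complex_of_real E * \<psi> n)"

definition eigenvalue :: "((int \<Rightarrow> complex) \<Rightarrow> (int \<Rightarrow> complex)) \<Rightarrow> real \<Rightarrow> bool" where
  "eigenvalue A E \<longleftrightarrow> (\<exists>\<psi>. eigenfunction A E \<psi>)"

definition exponentially_decaying :: "(int \<Rightarrow> complex) \<Rightarrow> bool" where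
  "exponentially_decaying \<psi> \<longleftrightarrow>
     (\<exists>A \<kappa>. A > 0 \<and> \<kappa> > 0 \<and> (\<forall>n. cmod (\<psi> n) \<le> A * exp (- \<kappa> * \<bar>real_of_int n\<bar>)))"

definition positive_up_to_constant :: "(int \<Rightarrow> complex) \<Rightarrow> bool" where
  "positive_up_to_constant \<psi> \<longleftrightarrow>
     (\<exists>k u. k \<noteq> 0 \<and> (\<forall>n. u n > 0 \<and> \<psi> n = k * complex_of_real (u n)))"

definition schroedinger :: "(int \<Rightarrow> real) \<Rightarrow> (int \<Rightarrow> complex) \<Rightarrow> (int \<Rightarrow> complex)" where
  "schroedinger V \<psi> = (\<lambda>n. \<psi> (n + 1) + \<psi> (n - 1) + complex_of_real (V n) * \<psi> n)"

definition H_bg ::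
    "real ^ 'd \<Rightarrow> real ^ 'd \<Rightarrow> (real ^ 'd \<Rightarrow> real) \<Rightarrow> real \<Rightarrow> (int \<Rightarrow> complex) \<Rightarrow> (int \<Rightarrow> complex)" where
  "H_bg \<alpha> \<theta> f c = schroedinger (\<lambda>n. c * f (\<theta> + real_of_int n *\<^sub>R \<alpha>))"

definition H_pert ::
    "real ^ 'd \<Rightarrow> real ^ 'd \<Rightarrow> (real ^ 'd \<Rightarrow> real) \<Rightarrow> real \<Rightarrow> (int \<Rightarrow> real) \<Rightarrow>
      (int \<Rightarrow> complex) \<Rightarrow> (int \<Rightarrow> complex)" where
  "H_pert \<alpha> \<theta> f c \<omega> = schroedinger (\<lambda>n. c * f (\<theta> + real_of_int n *\<^sub>R \<alpha>) + \<omega> n)"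

end

theory Submission
  imports Defs
begin

text \<open>
  A positive exponentially decaying solution \<open>\<psi>\<close> of \<open>H\<^sub>\<omega> \<psi> = E \<psi>\<close> is automatically a ground state: by the
  ground state representation \<open>H\<^sub>\<omega> \<le> E\<close> as quadratic forms, and by constancy of the Wronskian every other
  eigenfunction at \<open>E\<close> is a multiple of \<open>\<psi>\<close> (\<open>positive_decaying_solution_ground_state\<close>). So the task is to
  choose the values \<open>\<omega> n \<in> {0, \<lambda>}\<close> such that \<open>E\<close> has such a solution. In terms of the ratios
  \<open>\<rho> n = \<psi> (n + 1) / \<psi> n\<close> the equation is the Riccati recursion \<open>\<rho> n = E - V n - \<omega> n - 1 / \<rho> (n - 1)\<close>,
  and choosing \<open>\<omega>\<close> means steering this recursion with two controls.

  Let \<open>E\<^sup>*\<close> be the top of the background spectrum and \<open>E\<^sup>* + \<lambda> / 2 < E < E\<^sup>* + \<lambda>\<close>. Since \<open>E\<close> lies above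
  the background spectrum by at least \<open>\<lambda> / 2\<close>, the Green's function \<open>G\<close> of the background at \<open>E\<close> with pole
  \<open>a\<close> is positive and decays at least like \<open>(1 + 2 \<lambda>) ^ (- \<bar>n - a\<bar>)\<close> (\<open>green_function\<close>, a Combes-Thomas
  estimate; the rate available from a gap \<open>\<delta>\<close> is of order \<open>sqrt \<delta>\<close>, much more than \<open>\<lambda>\<close> for small \<open>\<lambda>\<close>).
  Take \<open>\<psi> = G\<close> and \<open>\<omega> = 0\<close> up to the site \<open>a\<close>. To the right of \<open>a\<close> proceed greedily: put \<open>\<omega> n = \<lambda>\<close>,
  unless this would push the ratio \<open>\<rho> n\<close> below the ratio \<open>r n = G (n + 1) / G n\<close> of the decaying
  background solution; in that case put \<open>\<omega> n = 0\<close>. Then \<open>\<rho> \<ge> r > 0\<close> always, so \<open>\<psi>\<close> is positive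
  (\<open>greedy_control\<close>).

  As soon as the value \<open>0\<close> has been chosen once, \<open>0 \<le> \<rho> - r \<le> \<lambda>\<close>, and this persists: a step with
  \<open>\<omega> = \<lambda>\<close> turns the difference \<open>d\<close> into \<open>d / (\<rho> r) - \<lambda> \<le> \<lambda>\<close>, because the smallness of the potential
  forces \<open>r \<ge> 3 / 4\<close> and thus \<open>\<rho> r \<ge> 1 / 2\<close>. This is where the coupling \<open>c\<close> has to be small. Hence \<open>\<psi> / G\<close>
  grows at most like \<open>(1 + 4 \<lambda> / 3) ^ n\<close>, and \<open>\<psi>\<close> decays exponentially (\<open>steered_solution_from\<close>).

  It remains to see that for a suitable \<open>a\<close> the value \<open>0\<close> is chosen at some point. Otherwise, for every
  \<open>a\<close>, the background has at energy \<open>E - \<lambda>\<close> a positive solution on the half-line to the right of \<open>a\<close>.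
  Letting \<open>a\<close> tend to minus infinity gives \<open>H \<le> E - \<lambda>\<close> for the background (\<open>form_le_if_positive_ratios\<close>),
  which contradicts \<open>E - \<lambda> < E\<^sup>*\<close> (\<open>steered_ground_state\<close>).

  The operator theory needed for this is elementary, because all operators are bounded and tridiagonal:
  a coercive tridiagonal operator is onto (\<open>coercive_tridiag_surj\<close>), which gives both the Green's function
  and the identification of the top of the spectrum with the best constant in \<open>H \<le> E\<close>
  (\<open>largest_energy_top_energy\<close>).
\<close>


section \<open>Square-summable sequences\<close>

definition l2_norm_sq :: "(int \<Rightarrow> complex) \<Rightarrow> real" where
  "l2_norm_sq \<phi> = (\<Sum>\<^sub>\<infinity>n. (cmod (\<phi> n))\<^sup>2)"

text \<open>The real part of the inner product: \<open>x \<bullet> y = Re (cnj x * y)\<close> for complex numbers. Every quadratic form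
  below is real, so the imaginary part never has to be carried along.\<close>

definition pairing :: "(int \<Rightarrow> complex) \<Rightarrow> (int \<Rightarrow> complex) \<Rightarrow> real" where
  "pairing \<phi> \<eta> = (\<Sum>\<^sub>\<infinity>n. \<phi> n \<bullet> \<eta> n)"

lemma bij_shift_int: "bij_betw (\<lambda>n::int. n + k) UNIV UNIV"
  by (rule bij_betwI[where g = "\<lambda>n. n - k"]) auto

lemma summable_shift_iff:
  fixes g :: "int \<Rightarrow> real"
  shows "(\<lambda>n. g (n + k)) summable_on UNIV \<longleftrightarrow> g summable_on UNIV"
  using summable_on_reindex_bij_betw[OF bij_shift_int, of g] by simp

lemma infsum_shift:
  fixes g :: "int \<Rightarrow> real"
  shows "(\<Sum>\<^sub>\<infinity>n. g (n + k)) = (\<Sum>\<^sub>\<infinity>n. g n)"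
  using infsum_reindex_bij_betw[OF bij_shift_int, of g] by simp

lemma l2_dominated:
  assumes "g summable_on UNIV" "\<And>n. (cmod (\<phi> n))\<^sup>2 \<le> g n"
  shows "\<phi> \<in> l2" "l2_norm_sq \<phi> \<le> infsum g UNIV"
proof -
  have s: "(\<lambda>n. (cmod (\<phi> n))\<^sup>2) summable_on UNIV"
    by (rule summable_on_comparison_test[OF assms(1)]) (use assms in auto)
  show "\<phi> \<in> l2" using s by (simp add: l2_def)
  show "l2_norm_sq \<phi> \<le> infsum g UNIV"
    unfolding l2_norm_sq_def by (rule infsum_mono[OF s assms(1)]) (use assms in auto)
qed

lemma l2_summable: "\<phi> \<in> l2 \<Longrightarrow> (\<lambda>n. (cmod (\<phi> n))\<^sup>2) summable_on UNIV"
  by (simp add: l2_def)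

lemma l2_shift: "\<phi> \<in> l2 \<Longrightarrow> (\<lambda>n. \<phi> (n + k)) \<in> l2"
  using summable_shift_iff[of "\<lambda>n. (cmod (\<phi> n))\<^sup>2" k] by (simp add: l2_def)

lemma l2_shift_minus: "\<phi> \<in> l2 \<Longrightarrow> (\<lambda>n. \<phi> (n - 1)) \<in> l2"
  using l2_shift[of \<phi> "-1"] by simp

lemma l2_norm_sq_shift: "l2_norm_sq (\<lambda>n. \<phi> (n + k)) = l2_norm_sq \<phi>"
  using infsum_shift[of "\<lambda>n. (cmod (\<phi> n))\<^sup>2" k] by (simp add: l2_norm_sq_def)

lemma cmod_add_square_le: "(cmod (x + y))\<^sup>2 \<le> 2 * (cmod x)\<^sup>2 + 2 * (cmod y)\<^sup>2"
proof -
  have "(cmod (x + y))\<^sup>2 \<le> (cmod x + cmod y)\<^sup>2"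
    by (rule power_mono) (auto intro: norm_triangle_ineq)
  also have "\<dots> \<le> 2 * (cmod x)\<^sup>2 + 2 * (cmod y)\<^sup>2"
    using sum_squares_bound[of "cmod x" "cmod y"] by (simp add: power2_sum)
  finally show ?thesis .
qed

lemma l2_add:
  assumes "\<phi> \<in> l2" "\<eta> \<in> l2"
  shows "(\<lambda>n. \<phi> n + \<eta> n) \<in> l2" "l2_norm_sq (\<lambda>n. \<phi> n + \<eta> n) \<le> 2 * l2_norm_sq \<phi> + 2 * l2_norm_sq \<eta>"
proof -
  have s: "(\<lambda>n. 2 * (cmod (\<phi> n))\<^sup>2 + 2 * (cmod (\<eta> n))\<^sup>2) summable_on UNIV"
    using assms by (intro summable_on_add summable_on_cmult_right l2_summable)
  show "(\<lambda>n. \<phi> n + \<eta> n) \<in> l2"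
    by (rule l2_dominated(1)[OF s]) (rule cmod_add_square_le)
  have "l2_norm_sq (\<lambda>n. \<phi> n + \<eta> n) \<le> (\<Sum>\<^sub>\<infinity>n. 2 * (cmod (\<phi> n))\<^sup>2 + 2 * (cmod (\<eta> n))\<^sup>2)"
    by (rule l2_dominated(2)[OF s]) (rule cmod_add_square_le)
  also have "\<dots> = 2 * l2_norm_sq \<phi> + 2 * l2_norm_sq \<eta>"
    using assms by (simp add: infsum_add infsum_cmult_right' l2_norm_sq_def summable_on_cmult_right l2_summable)
  finally show "l2_norm_sq (\<lambda>n. \<phi> n + \<eta> n) \<le> 2 * l2_norm_sq \<phi> + 2 * l2_norm_sq \<eta>" .
qed

lemma l2_mult:
  assumes "\<phi> \<in> l2" "\<And>n. cmod (a n) \<le> K"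
  shows "(\<lambda>n. a n * \<phi> n) \<in> l2"
proof (rule l2_dominated(1))
  show "(\<lambda>n. K\<^sup>2 * (cmod (\<phi> n))\<^sup>2) summable_on UNIV"
    using assms by (intro summable_on_cmult_right l2_summable)
  show "(cmod (a n * \<phi> n))\<^sup>2 \<le> K\<^sup>2 * (cmod (\<phi> n))\<^sup>2" for n
    using assms(2)[of n] by (auto simp: norm_mult power_mult_distrib intro!: mult_right_mono power_mono)
qed

lemma l2_scale: "\<phi> \<in> l2 \<Longrightarrow> (\<lambda>n. k * \<phi> n) \<in> l2"
  by (rule l2_mult[where K = "cmod k"]) auto

lemma l2_norm_sq_scale: "l2_norm_sq (\<lambda>n. k * \<phi> n) = (cmod k)\<^sup>2 * l2_norm_sq \<phi>"
  by (simp add: l2_norm_sq_def norm_mult power_mult_distrib infsum_cmult_right')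

lemma l2_diff: "\<phi> \<in> l2 \<Longrightarrow> \<eta> \<in> l2 \<Longrightarrow> (\<lambda>n. \<phi> n - \<eta> n) \<in> l2"
  using l2_add(1)[of \<phi> "\<lambda>n. (-1) * \<eta> n"] l2_scale[of \<eta> "-1"] by simp

lemma l2_norm_sq_nonneg: "0 \<le> l2_norm_sq \<phi>"
  unfolding l2_norm_sq_def by (rule infsum_nonneg) auto

lemma cmod_square_le_l2_norm_sq:
  assumes "\<phi> \<in> l2"
  shows "(cmod (\<phi> n))\<^sup>2 \<le> l2_norm_sq \<phi>"
proof -
  have "(\<Sum>\<^sub>\<infinity>k\<in>{n}. (cmod (\<phi> k))\<^sup>2) \<le> l2_norm_sq \<phi>"
    unfolding l2_norm_sq_def using assms
    by (intro infsum_mono_neutral) (auto simp: l2_def)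
  then show ?thesis by simp
qed

lemma l2_norm_sq_eq_0_iff: "\<phi> \<in> l2 \<Longrightarrow> l2_norm_sq \<phi> = 0 \<longleftrightarrow> \<phi> = (\<lambda>n. 0)"
proof
  assume "\<phi> \<in> l2" "l2_norm_sq \<phi> = 0"
  then have "(cmod (\<phi> n))\<^sup>2 \<le> 0" for n
    using cmod_square_le_l2_norm_sq[of \<phi> n] by simp
  then show "\<phi> = (\<lambda>n. 0)" by auto
qed (simp add: l2_norm_sq_def)

lemma l2_norm_eq: "l2_norm \<phi> = sqrt (l2_norm_sq \<phi>)"
  by (simp add: l2_norm_def l2_norm_sq_def)

lemma zero_l2: "(\<lambda>n. 0) \<in> l2"
  by (simp add: l2_def)

lemma inner_le_squares: "\<bar>x \<bullet> (y::complex)\<bar> \<le> ((cmod x)\<^sup>2 + (cmod y)\<^sup>2) / 2"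
  using Cauchy_Schwarz_ineq2[of x y] sum_squares_bound[of "cmod x" "cmod y"] by simp

lemma inner_summable:
  assumes "\<phi> \<in> l2" "\<eta> \<in> l2"
  shows "(\<lambda>n. \<phi> n \<bullet> \<eta> n) summable_on UNIV"
proof -
  have "(\<lambda>n. ((cmod (\<phi> n))\<^sup>2 + (cmod (\<eta> n))\<^sup>2) * (1/2)) summable_on UNIV"
    using assms by (intro summable_on_cmult_left summable_on_add l2_summable)
  then have "(\<lambda>n. norm (\<phi> n \<bullet> \<eta> n)) summable_on UNIV"
    by (rule summable_on_comparison_test) (use inner_le_squares in auto)
  then show ?thesis by (rule abs_summable_summable)
qed

lemma pairing_self: "pairing \<phi> \<phi> = l2_norm_sq \<phi>"
  by (simp add: pairing_def l2_norm_sq_def power2_norm_eq_inner)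

lemma pairing_commute: "pairing \<phi> \<eta> = pairing \<eta> \<phi>"
  by (simp add: pairing_def inner_commute)

lemma pairing_diff:
  assumes "\<phi> \<in> l2" "\<eta> \<in> l2" "\<xi> \<in> l2"
  shows "pairing \<phi> (\<lambda>n. \<eta> n - \<xi> n) = pairing \<phi> \<eta> - pairing \<phi> \<xi>"
  unfolding pairing_def inner_diff_right
  using inner_summable assms infsum_add[of "\<lambda>n. \<phi> n \<bullet> \<eta> n" UNIV "\<lambda>n. - (\<phi> n \<bullet> \<xi> n)"]
  by (simp add: infsum_uminus summable_on_uminus)

lemma pairing_scale: "pairing \<phi> (\<lambda>n. of_real s * \<eta> n) = s * pairing \<phi> \<eta>"
proof -
  have "\<phi> n \<bullet> (of_real s * \<eta> n) = s * (\<phi> n \<bullet> \<eta> n)" for n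
    by (simp add: inner_complex_def algebra_simps)
  then show ?thesis by (simp add: pairing_def infsum_cmult_right')
qed

lemma pairing_le:
  assumes "\<phi> \<in> l2" "\<eta> \<in> l2"
  shows "\<bar>pairing \<phi> \<eta>\<bar> \<le> (l2_norm_sq \<phi> + l2_norm_sq \<eta>) / 2"
proof -
  have s: "(\<lambda>n. ((cmod (\<phi> n))\<^sup>2 + (cmod (\<eta> n))\<^sup>2) * (1/2)) summable_on UNIV"
    using assms by (intro summable_on_cmult_left summable_on_add l2_summable)
  have i: "infsum (\<lambda>n. ((cmod (\<phi> n))\<^sup>2 + (cmod (\<eta> n))\<^sup>2) * (1/2)) UNIV = (l2_norm_sq \<phi> + l2_norm_sq \<eta>) / 2"
    using assms by (simp only: infsum_cmult_left' l2_norm_sq_def infsum_add[OF l2_summable l2_summable])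
  have "norm (pairing \<phi> \<eta>) \<le> (l2_norm_sq \<phi> + l2_norm_sq \<eta>) / 2"
    unfolding pairing_def i[symmetric]
    by (rule norm_infsum_le) (use inner_summable assms s inner_le_squares in \<open>auto intro!: has_sum_infsum\<close>)
  then show ?thesis by simp
qed

lemma l2_norm_sq_diff:
  assumes "\<phi> \<in> l2" "\<eta> \<in> l2"
  shows "l2_norm_sq (\<lambda>n. \<phi> n - of_real s * \<eta> n) = l2_norm_sq \<phi> - 2 * s * pairing \<phi> \<eta> + s\<^sup>2 * l2_norm_sq \<eta>"
proof -
  have d: "(\<lambda>n. \<phi> n - of_real s * \<eta> n) \<in> l2"
    using assms by (intro l2_diff l2_scale)
  have "l2_norm_sq (\<lambda>n. \<phi> n - of_real s * \<eta> n)
      = pairing (\<lambda>n. \<phi> n - of_real s * \<eta> n) \<phi> - s * pairing (\<lambda>n. \<phi> n - of_real s * \<eta> n) \<eta>"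
    using pairing_diff[OF d assms(1) l2_scale[OF assms(2)], of "of_real s"]
    by (simp add: pairing_self pairing_scale)
  moreover have "pairing (\<lambda>n. \<phi> n - of_real s * \<eta> n) \<xi> = pairing \<xi> \<phi> - s * pairing \<xi> \<eta>"
    if "\<xi> \<in> l2" for \<xi>
    using pairing_diff[OF that assms(1) l2_scale[OF assms(2)], of "of_real s"]
    by (simp add: pairing_commute pairing_scale)
  ultimately show ?thesis
    using assms by (simp add: pairing_self pairing_commute[of \<eta> \<phi>] power2_eq_square algebra_simps)
qed

section \<open>Bounded tridiagonal operators and the Lax-Milgram lemma\<close>

definition tridiag ::
    "(int \<Rightarrow> complex) \<Rightarrow> (int \<Rightarrow> complex) \<Rightarrow> (int \<Rightarrow> complex) \<Rightarrow> (int \<Rightarrow> complex) \<Rightarrow> (int \<Rightarrow> complex)" where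
  "tridiag a b d \<phi> = (\<lambda>n. a n * \<phi> (n + 1) + b n * \<phi> (n - 1) + d n * \<phi> n)"

lemma tridiag_l2:
  assumes "\<phi> \<in> l2" "\<And>n. cmod (a n) \<le> K" "\<And>n. cmod (b n) \<le> K" "\<And>n. cmod (d n) \<le> K"
  shows "tridiag a b d \<phi> \<in> l2" "l2_norm_sq (tridiag a b d \<phi>) \<le> 9 * K\<^sup>2 * l2_norm_sq \<phi>"
proof -
  let ?g = "\<lambda>n. 3 * K\<^sup>2 * ((cmod (\<phi> (n + 1)))\<^sup>2 + (cmod (\<phi> (n - 1)))\<^sup>2 + (cmod (\<phi> n))\<^sup>2)"
  have l: "(\<lambda>n. (cmod (\<phi> (n + 1)))\<^sup>2) summable_on UNIV" "(\<lambda>n. (cmod (\<phi> (n - 1)))\<^sup>2) summable_on UNIV"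
    "(\<lambda>n. (cmod (\<phi> n))\<^sup>2) summable_on UNIV"
    using l2_summable[OF l2_shift[OF assms(1), of 1]] l2_summable[OF l2_shift_minus[OF assms(1)]]
      l2_summable[OF assms(1)] by simp_all
  have s: "?g summable_on UNIV"
    by (intro summable_on_cmult_right summable_on_add l)
  have le: "(cmod (tridiag a b d \<phi> n))\<^sup>2 \<le> ?g n" for n
  proof -
    define p q r where "p = cmod (\<phi> (n + 1))" and "q = cmod (\<phi> (n - 1))" and "r = cmod (\<phi> n)"
    have "cmod (tridiag a b d \<phi> n) \<le> cmod (a n * \<phi> (n + 1)) + cmod (b n * \<phi> (n - 1)) + cmod (d n * \<phi> n)"
      unfolding tridiag_def by (meson norm_triangle_le norm_triangle_ineq add_mono order_refl)
    also have "\<dots> \<le> K * p + K * q + K * r"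
      unfolding norm_mult p_def q_def r_def by (intro add_mono mult_right_mono assms) auto
    finally have "(cmod (tridiag a b d \<phi> n))\<^sup>2 \<le> (K * p + K * q + K * r)\<^sup>2"
      by (intro power_mono) auto
    also have "\<dots> = K\<^sup>2 * (p + q + r)\<^sup>2"
      by (simp add: power2_eq_square algebra_simps)
    also have "\<dots> \<le> K\<^sup>2 * (3 * (p\<^sup>2 + q\<^sup>2 + r\<^sup>2))"
    proof (rule mult_left_mono)
      show "(p + q + r)\<^sup>2 \<le> 3 * (p\<^sup>2 + q\<^sup>2 + r\<^sup>2)"
        using sum_squares_bound[of p q] sum_squares_bound[of p r] sum_squares_bound[of q r]
        by (simp add: power2_eq_square algebra_simps)
    qed auto
    finally show ?thesis by (simp add: p_def q_def r_def algebra_simps)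
  qed
  show "tridiag a b d \<phi> \<in> l2" by (rule l2_dominated(1)[OF s le])
  have "l2_norm_sq (tridiag a b d \<phi>) \<le> infsum ?g UNIV" by (rule l2_dominated(2)[OF s le])
  also have "\<dots> = 3 * K\<^sup>2 * (l2_norm_sq (\<lambda>n. \<phi> (n + 1)) + l2_norm_sq (\<lambda>n. \<phi> (n + (-1))) + l2_norm_sq \<phi>)"
    using l by (simp add: infsum_cmult_right' infsum_add summable_on_add l2_norm_sq_def)
  also have "\<dots> = 9 * K\<^sup>2 * l2_norm_sq \<phi>" unfolding l2_norm_sq_shift by simp
  finally show "l2_norm_sq (tridiag a b d \<phi>) \<le> 9 * K\<^sup>2 * l2_norm_sq \<phi>" .
qed

text \<open>Cauchy-Schwarz in the form \<open>0 \<le> \<parallel>\<eta> - m \<phi>\<parallel>\<^sup>2\<close>.\<close>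

lemma coercive_bounded_below:
  assumes "0 < m" "\<phi> \<in> l2" "\<eta> \<in> l2" "m * l2_norm_sq \<phi> \<le> pairing \<phi> \<eta>"
  shows "m\<^sup>2 * l2_norm_sq \<phi> \<le> l2_norm_sq \<eta>"
proof -
  have "0 \<le> l2_norm_sq (\<lambda>n. \<eta> n - of_real m * \<phi> n)" by (rule l2_norm_sq_nonneg)
  also have "\<dots> = l2_norm_sq \<eta> - 2 * m * pairing \<phi> \<eta> + m\<^sup>2 * l2_norm_sq \<phi>"
    using l2_norm_sq_diff[OF assms(3,2)] pairing_commute by simp
  also have "\<dots> \<le> l2_norm_sq \<eta> - 2 * m * (m * l2_norm_sq \<phi>) + m\<^sup>2 * l2_norm_sq \<phi>"
    using assms by (intro add_mono diff_mono mult_left_mono) auto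
  finally show ?thesis by (simp add: power2_eq_square)
qed

text \<open>The Lax-Milgram lemma. For a small step \<open>t\<close> the map \<open>\<phi> \<mapsto> \<phi> - t B \<phi>\<close> is a contraction, by expanding the
  square of its norm, so \<open>B\<close> is inverted by a Neumann series. The series converges at every site;
  since \<open>B\<close> couples only neighbouring sites, its sum solves the equation pointwise, and Fatou's
  lemma puts it into \<^term>\<open>l2\<close>.\<close>

lemma coercive_tridiag_surj:
  assumes K: "\<And>n. cmod (a n) \<le> K" "\<And>n. cmod (b n) \<le> K" "\<And>n. cmod (d n) \<le> K"
    and m: "0 < m"
    and co: "\<And>\<phi>. \<phi> \<in> l2 \<Longrightarrow> m * l2_norm_sq \<phi> \<le> pairing \<phi> (tridiag a b d \<phi>)"
    and g: "g \<in> l2"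
  shows "\<exists>\<phi>\<in>l2. tridiag a b d \<phi> = g"
proof -
  let ?B = "tridiag a b d"
  have B: "?B \<phi> \<in> l2" "l2_norm_sq (?B \<phi>) \<le> 9 * K\<^sup>2 * l2_norm_sq \<phi>" if "\<phi> \<in> l2" for \<phi>
    using tridiag_l2[of \<phi> a K b d, OF that K] by auto
  \<comment> \<open>\<open>M\<close> bounds the squared operator norm; the summand \<open>m\<^sup>2\<close> ensures that \<open>q\<close> is nonnegative.\<close>
  define M where "M = 9 * K\<^sup>2 + m\<^sup>2"
  have M: "M > 0" "m\<^sup>2 \<le> M" unfolding M_def using m by (auto intro: add_nonneg_pos)
  define t where "t = m / M"
  have t: "t > 0" using m M by (simp add: t_def)
  define q where "q = 1 - m\<^sup>2 / M"
  have q: "0 \<le> q" "q < 1" using m M by (auto simp: q_def)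
  define T where "T \<phi> = (\<lambda>n. \<phi> n - of_real t * ?B \<phi> n)" for \<phi>
  define D where "D k = (T ^^ k) (\<lambda>n. of_real t * g n)" for k
  have DS: "D (Suc k) = T (D k)" for k by (simp add: D_def)
  have contr: "l2_norm_sq (T \<phi>) \<le> q * l2_norm_sq \<phi>" if "\<phi> \<in> l2" for \<phi>
  proof -
    have "l2_norm_sq (T \<phi>) = l2_norm_sq \<phi> - 2 * t * pairing \<phi> (?B \<phi>) + t\<^sup>2 * l2_norm_sq (?B \<phi>)"
      unfolding T_def by (rule l2_norm_sq_diff[OF that B(1)[OF that]])
    also have "\<dots> \<le> l2_norm_sq \<phi> - 2 * t * (m * l2_norm_sq \<phi>) + t\<^sup>2 * (M * l2_norm_sq \<phi>)"
    proof (intro add_mono diff_mono mult_left_mono order_refl)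
      show "l2_norm_sq (?B \<phi>) \<le> M * l2_norm_sq \<phi>"
        by (rule order_trans[OF B(2)[OF that] mult_right_mono]) (auto simp: M_def l2_norm_sq_nonneg)
    qed (use co[OF that] t in auto)
    also have "\<dots> = q * l2_norm_sq \<phi>"
      using M by (simp add: q_def t_def power2_eq_square field_simps)
    finally show ?thesis .
  qed
  have Dl2: "D k \<in> l2" for k
  proof (induction k)
    case 0 show ?case using l2_scale[OF g] by (simp add: D_def)
  next
    case (Suc k) then show ?case unfolding DS T_def by (intro l2_diff l2_scale B(1))
  qed
  have Dq: "l2_norm_sq (D k) \<le> q ^ k * (t\<^sup>2 * l2_norm_sq g)" for k
  proof (induction k)
    case 0 show ?case by (simp add: D_def l2_norm_sq_scale)
  next
    case (Suc k)
    have "l2_norm_sq (D (Suc k)) \<le> q * l2_norm_sq (D k)" unfolding DS by (rule contr[OF Dl2])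
    also have "\<dots> \<le> q * (q ^ k * (t\<^sup>2 * l2_norm_sq g))" by (rule mult_left_mono[OF Suc q(1)])
    finally show ?case by (simp add: mult.assoc)
  qed
  define X where "X k = (\<lambda>n. \<Sum>j<k. D j n)" for k
  have Xl2: "X k \<in> l2" for k
  proof (induction k)
    case 0 show ?case by (simp add: X_def zero_l2)
  next
    case (Suc k)
    show ?case using l2_add(1)[OF Suc Dl2[of k]] by (simp add: X_def)
  qed
  have X0: "X 0 = (\<lambda>n. 0)" and XS: "X (Suc k) = (\<lambda>n. X k n + D k n)" for k
    by (auto simp: X_def)
  \<comment> \<open>The series telescopes under \<open>t B\<close>.\<close>
  have BX: "of_real t * ?B (X k) n = of_real t * g n - D k n" for k n
  proof (induction k)
    case 0 show ?case by (simp add: X0 tridiag_def D_def)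
  next
    case (Suc k)
    have "?B (X (Suc k)) n = ?B (X k) n + ?B (D k) n"
      by (simp add: XS tridiag_def algebra_simps)
    moreover have "of_real t * ?B (D k) n = D k n - D (Suc k) n"
      by (simp add: DS T_def)
    ultimately show ?case using Suc by (simp add: distrib_left)
  qed
  have sq: "0 \<le> sqrt q" "sqrt q < 1" using q by auto
  have Dn: "cmod (D k n) \<le> sqrt q ^ k * sqrt (t\<^sup>2 * l2_norm_sq g)" for k n
  proof -
    have "(cmod (D k n))\<^sup>2 \<le> q ^ k * (t\<^sup>2 * l2_norm_sq g)"
      using cmod_square_le_l2_norm_sq[OF Dl2] Dq by (rule order_trans)
    then have "cmod (D k n) \<le> sqrt (q ^ k * (t\<^sup>2 * l2_norm_sq g))" by (rule real_le_rsqrt)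
    then show ?thesis by (simp add: real_sqrt_mult real_sqrt_power)
  qed
  have sm: "summable (\<lambda>k. D k n)" for n
    by (rule summable_comparison_test'[where g = "\<lambda>k. sqrt q ^ k * sqrt (t\<^sup>2 * l2_norm_sq g)"])
       (use Dn sq in \<open>auto intro!: summable_mult2 summable_geometric\<close>)
  define \<Phi> where "\<Phi> n = (\<Sum>k. D k n)" for n
  have lim: "(\<lambda>k. X k n) \<longlonglongrightarrow> \<Phi> n" for n
    unfolding X_def \<Phi>_def by (rule summable_LIMSEQ[OF sm])
  have "?B \<Phi> n = g n" for n
  proof -
    have "(\<lambda>k. of_real t * ?B (X k) n) \<longlonglongrightarrow> of_real t * ?B \<Phi> n"
      unfolding tridiag_def by (intro tendsto_intros lim)
    moreover have "(\<lambda>k. of_real t * ?B (X k) n) \<longlonglongrightarrow> of_real t * g n - 0"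
      unfolding BX by (intro tendsto_intros summable_LIMSEQ_zero[OF sm])
    ultimately show ?thesis using LIMSEQ_unique t by fastforce
  qed
  then have eq: "?B \<Phi> = g" by auto
  \<comment> \<open>The partial sums are bounded in norm, because their images under the operator are.\<close>
  have Xb: "l2_norm_sq (X k) \<le> 4 * l2_norm_sq g / m\<^sup>2" for k
  proof -
    have "of_real t * ?B (X k) n = of_real t * g n + - D k n" for n
      using BX[of k n] by simp
    then have "t\<^sup>2 * l2_norm_sq (?B (X k)) = l2_norm_sq (\<lambda>n. of_real t * g n + - D k n)"
      using l2_norm_sq_scale[of "of_real t" "?B (X k)"] t by simp
    also have "\<dots> \<le> 2 * l2_norm_sq (\<lambda>n. of_real t * g n) + 2 * l2_norm_sq (\<lambda>n. - D k n)"
      using l2_add(2)[OF l2_scale[OF g] l2_scale[OF Dl2[of k], of "-1"]] by simp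
    also have "\<dots> = 2 * (t\<^sup>2 * l2_norm_sq g) + 2 * l2_norm_sq (D k)"
      by (simp add: l2_norm_sq_scale) (simp add: l2_norm_sq_def)
    also have "l2_norm_sq (D k) \<le> 1 * (t\<^sup>2 * l2_norm_sq g)"
      by (rule order_trans[OF Dq mult_right_mono]) (use q l2_norm_sq_nonneg[of g] in \<open>auto intro: power_le_one\<close>)
    finally have "l2_norm_sq (?B (X k)) \<le> 4 * l2_norm_sq g" using t by simp
    moreover have "m\<^sup>2 * l2_norm_sq (X k) \<le> l2_norm_sq (?B (X k))"
      by (rule coercive_bounded_below[OF m Xl2 B(1)[OF Xl2] co[OF Xl2]])
    ultimately show ?thesis using m by (simp add: field_simps)
  qed
  have "\<Phi> \<in> l2" unfolding l2_def mem_Collect_eq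
  proof (rule nonneg_bdd_above_summable_on)
    show "bdd_above (sum (\<lambda>n. (cmod (\<Phi> n))\<^sup>2) ` {F. F \<subseteq> UNIV \<and> finite F})"
    proof (rule bdd_aboveI2)
      fix F :: "int set" assume F: "F \<in> {F. F \<subseteq> UNIV \<and> finite F}"
      have "(\<lambda>k. \<Sum>n\<in>F. (cmod (X k n))\<^sup>2) \<longlonglongrightarrow> (\<Sum>n\<in>F. (cmod (\<Phi> n))\<^sup>2)"
        by (intro tendsto_intros lim)
      moreover have "(\<Sum>n\<in>F. (cmod (X k n))\<^sup>2) \<le> 4 * l2_norm_sq g / m\<^sup>2" for k
      proof -
        have "(\<Sum>n\<in>F. (cmod (X k n))\<^sup>2) \<le> l2_norm_sq (X k)"
          unfolding l2_norm_sq_def using F l2_summable[OF Xl2]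
          by (intro finite_sum_le_infsum) auto
        then show ?thesis using Xb[of k] by simp
      qed
      ultimately show "(\<Sum>n\<in>F. (cmod (\<Phi> n))\<^sup>2) \<le> 4 * l2_norm_sq g / m\<^sup>2"
        by (intro LIMSEQ_le_const2) auto
    qed
  qed auto
  with eq show ?thesis by blast
qed


section \<open>Energy forms and the top of the spectrum\<close>

text \<open>The quadratic form of \<^term>\<open>schroedinger V\<close>, with its two equal hopping terms merged by translation.\<close>

definition energy :: "(int \<Rightarrow> real) \<Rightarrow> (int \<Rightarrow> complex) \<Rightarrow> real" where
  "energy V \<phi> = (\<Sum>\<^sub>\<infinity>n. 2 * (\<phi> n \<bullet> \<phi> (n + 1)) + V n * (cmod (\<phi> n))\<^sup>2)"

definition form_le :: "(int \<Rightarrow> real) \<Rightarrow> real \<Rightarrow> bool" where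
  "form_le V E \<longleftrightarrow> (\<forall>\<phi>\<in>l2. energy V \<phi> \<le> E * l2_norm_sq \<phi>)"

lemma inner_tridiag_summable:
  assumes "\<phi> \<in> l2" "\<eta> \<in> l2" "\<And>n. cmod (a n) \<le> K" "\<And>n. cmod (b n) \<le> K" "\<And>n. cmod (d n) \<le> K"
  shows "(\<lambda>n. \<phi> n \<bullet> (a n * \<eta> (n + 1))) summable_on UNIV"
    "(\<lambda>n. \<phi> (n + 1) \<bullet> (b (n + 1) * \<eta> n)) summable_on UNIV"
    "(\<lambda>n. \<phi> n \<bullet> (d n * \<eta> n)) summable_on UNIV"
  by (intro inner_summable assms l2_mult[where K = K] l2_shift)+

text \<open>Moving the backward hopping term one site to the right collects the two interactions across each bond.\<close>

lemma pairing_tridiag: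
  assumes "\<phi> \<in> l2" "\<eta> \<in> l2" "\<And>n. cmod (a n) \<le> K" "\<And>n. cmod (b n) \<le> K" "\<And>n. cmod (d n) \<le> K"
  shows "pairing \<phi> (tridiag a b d \<eta>) =
    (\<Sum>\<^sub>\<infinity>n. \<phi> n \<bullet> (a n * \<eta> (n + 1)) + \<phi> (n + 1) \<bullet> (b (n + 1) * \<eta> n) + \<phi> n \<bullet> (d n * \<eta> n))"
proof -
  note s = inner_tridiag_summable[of \<phi> \<eta> a K b d, OF assms]
  let ?g = "\<lambda>n. \<phi> n \<bullet> (b n * \<eta> (n - 1))"
  have g: "?g summable_on UNIV" "(\<Sum>\<^sub>\<infinity>n. ?g n) = (\<Sum>\<^sub>\<infinity>n. \<phi> (n + 1) \<bullet> (b (n + 1) * \<eta> n))"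
    using summable_shift_iff[of ?g 1] s(2) infsum_shift[of ?g 1] by simp_all
  have "pairing \<phi> (tridiag a b d \<eta>) =
      (\<Sum>\<^sub>\<infinity>n. \<phi> n \<bullet> (a n * \<eta> (n + 1)) + ?g n + \<phi> n \<bullet> (d n * \<eta> n))"
    by (simp add: pairing_def tridiag_def inner_add_right)
  also have "\<dots> = (\<Sum>\<^sub>\<infinity>n. \<phi> n \<bullet> (a n * \<eta> (n + 1))) + (\<Sum>\<^sub>\<infinity>n. ?g n) + (\<Sum>\<^sub>\<infinity>n. \<phi> n \<bullet> (d n * \<eta> n))"
    using s g by (simp add: infsum_add summable_on_add)
  also have "\<dots> = (\<Sum>\<^sub>\<infinity>n. \<phi> n \<bullet> (a n * \<eta> (n + 1)) + \<phi> (n + 1) \<bullet> (b (n + 1) * \<eta> n) + \<phi> n \<bullet> (d n * \<eta> n))"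
    unfolding g(2) using s by (simp add: infsum_add summable_on_add)
  finally show ?thesis .
qed

lemma schroedinger_tridiag:
  "schroedinger V = tridiag (\<lambda>_. 1) (\<lambda>_. 1) (\<lambda>n. of_real (V n))"
  by (auto simp: schroedinger_def tridiag_def)

lemma schroedinger_l2:
  assumes "\<And>n. \<bar>V n\<bar> \<le> v" "\<phi> \<in> l2"
  shows "schroedinger V \<phi> \<in> l2"
  unfolding schroedinger_tridiag
  by (rule tridiag_l2(1)[where K = "max 1 v"]) (use assms in \<open>auto simp: le_max_iff_disj\<close>)

lemma inner_of_real_mult: "x \<bullet> (of_real r * y) = r * (x \<bullet> (y::complex))"
  by (simp add: inner_complex_def algebra_simps)

lemma energy_eq_pairing:
  assumes "\<And>n. \<bar>V n\<bar> \<le> v" "\<phi> \<in> l2"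
  shows "energy V \<phi> = pairing \<phi> (schroedinger V \<phi>)"
proof -
  have "pairing \<phi> (schroedinger V \<phi>) =
     (\<Sum>\<^sub>\<infinity>n. \<phi> n \<bullet> (1 * \<phi> (n + 1)) + \<phi> (n + 1) \<bullet> (1 * \<phi> n) + \<phi> n \<bullet> (of_real (V n) * \<phi> n))"
    unfolding schroedinger_tridiag
    by (rule pairing_tridiag[where K = "max 1 v"]) (use assms in \<open>auto simp: le_max_iff_disj\<close>)
  also have "\<dots> = energy V \<phi>"
    unfolding energy_def
    by (rule infsum_cong) (simp add: inner_of_real_mult power2_norm_eq_inner inner_commute)
  finally show ?thesis by simp
qed

lemma schroedinger_symmetric:
  assumes "\<And>n. \<bar>V n\<bar> \<le> v" "\<phi> \<in> l2" "\<eta> \<in> l2"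
  shows "pairing \<phi> (schroedinger V \<eta>) = pairing \<eta> (schroedinger V \<phi>)"
proof -
  have "pairing \<phi> (schroedinger V \<eta>) =
      (\<Sum>\<^sub>\<infinity>n. \<phi> n \<bullet> (1 * \<eta> (n + 1)) + \<phi> (n + 1) \<bullet> (1 * \<eta> n) + \<phi> n \<bullet> (of_real (V n) * \<eta> n))"
    if "\<phi> \<in> l2" "\<eta> \<in> l2" for \<phi> \<eta>
    unfolding schroedinger_tridiag
    by (rule pairing_tridiag[where K = "max 1 v"]) (use assms that in \<open>auto simp: le_max_iff_disj\<close>)
  from this[OF assms(2,3)] this[OF assms(3,2)] show ?thesis
    by (simp add: inner_of_real_mult inner_commute add_ac)
qed

text \<open>For a real \<open>z\<close> above the form bound the factor \<open>\<mu> = - 1\<close> makes the operator coercive; for a non-real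
  \<open>z\<close> the symmetric part drops out after multiplication by \<open>\<mu> = \<plusminus>\<i>\<close>, leaving \<open>\<bar>Im z\<bar>\<close>.\<close>

lemma coercive_imp_resolvent:
  assumes V: "\<And>n. \<bar>V n\<bar> \<le> v" and \<mu>: "cmod \<mu> = 1" and m: "0 < m"
    and co: "\<And>\<phi>. \<phi> \<in> l2 \<Longrightarrow> m * l2_norm_sq \<phi> \<le> pairing \<phi> (\<lambda>n. \<mu> * (schroedinger V \<phi> n - z * \<phi> n))"
  shows "z \<in> l2_resolvent_set (schroedinger V)"
proof -
  let ?R = "\<lambda>\<phi> n. schroedinger V \<phi> n - z * \<phi> n"
  let ?B = "tridiag (\<lambda>_. \<mu>) (\<lambda>_. \<mu>) (\<lambda>n. \<mu> * (of_real (V n) - z))"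
  have eq: "?B \<phi> = (\<lambda>n. \<mu> * ?R \<phi> n)" for \<phi>
    by (auto simp: tridiag_def schroedinger_def algebra_simps)
  have \<mu>0: "\<mu> \<noteq> 0" using \<mu> by auto
  have R: "?R \<phi> \<in> l2" if "\<phi> \<in> l2" for \<phi>
    using that by (intro l2_diff schroedinger_l2[of V v, OF V] l2_scale)
  have below: "m\<^sup>2 * l2_norm_sq \<phi> \<le> l2_norm_sq (?R \<phi>)" if "\<phi> \<in> l2" for \<phi>
    using coercive_bounded_below[OF m that l2_scale[OF R[OF that]] co[OF that]]
    by (simp add: l2_norm_sq_scale \<mu>)
  have inj: "inj_on ?R l2"
  proof (rule inj_onI)
    fix \<phi> \<eta> assume h: "\<phi> \<in> l2" "\<eta> \<in> l2" "?R \<phi> = ?R \<eta>"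
    let ?\<xi> = "\<lambda>n. \<phi> n - \<eta> n"
    have "?R ?\<xi> = (\<lambda>n. ?R \<phi> n - ?R \<eta> n)"
      by (auto simp: schroedinger_def algebra_simps)
    also have "\<dots> = (\<lambda>n. 0)"
    proof
      fix n
      show "?R \<phi> n - ?R \<eta> n = 0" using fun_cong[OF h(3), of n] by simp
    qed
    finally have "m\<^sup>2 * l2_norm_sq ?\<xi> \<le> 0"
      using below[OF l2_diff[OF h(1,2)]] by (simp add: l2_norm_sq_def)
    then have "l2_norm_sq ?\<xi> = 0"
      using m l2_norm_sq_nonneg[of ?\<xi>] by (simp add: mult_le_0_iff)
    then have "?\<xi> = (\<lambda>n. 0)" using l2_norm_sq_eq_0_iff[OF l2_diff[OF h(1,2)]] by simp
    then show "\<phi> = \<eta>" by (auto simp: fun_eq_iff)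
  qed
  have surj: "\<exists>\<phi>\<in>l2. ?R \<phi> = g" if g: "g \<in> l2" for g
  proof -
    let ?K = "1 + v + cmod z"
    have v: "v \<ge> 0" using V[of 0] by linarith
    have "cmod (\<mu> * (of_real (V n) - z)) \<le> ?K" for n
      using norm_triangle_ineq4[of "of_real (V n)" z] V[of n] \<mu> by (simp add: norm_mult)
    moreover have "cmod \<mu> \<le> ?K" using \<mu> v by simp
    ultimately have "\<exists>\<phi>\<in>l2. ?B \<phi> = (\<lambda>n. \<mu> * g n)"
      using co by (intro coercive_tridiag_surj[where K = ?K and m = m] m l2_scale g) (simp_all add: eq)
    then obtain \<phi> where "\<phi> \<in> l2" "?B \<phi> = (\<lambda>n. \<mu> * g n)" by blast
    then show ?thesis using \<mu>0 by (intro bexI[of _ \<phi>]) (auto simp: eq fun_eq_iff)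
  qed
  have "bij_betw ?R l2 l2"
    unfolding bij_betw_def using inj R surj by fastforce
  moreover have "l2_norm \<phi> \<le> (1 / m) * l2_norm (?R \<phi>)" if "\<phi> \<in> l2" for \<phi>
  proof -
    have "sqrt (m\<^sup>2 * l2_norm_sq \<phi>) \<le> sqrt (l2_norm_sq (?R \<phi>))" using below[OF that] by simp
    then show ?thesis using m by (simp add: l2_norm_eq real_sqrt_mult field_simps)
  qed
  ultimately show ?thesis unfolding l2_resolvent_set_def by blast
qed

lemma form_le_imp_spectrum_le:
  assumes V: "\<And>n. \<bar>V n\<bar> \<le> v" and le: "form_le V E"
  shows "l2_spectrum (schroedinger V) \<subseteq> complex_of_real ` {..E}"
proof (rule subsetI, rule ccontr)
  fix z assume z: "z \<in> l2_spectrum (schroedinger V)" and n: "z \<notin> complex_of_real ` {..E}"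
  have "z \<in> l2_resolvent_set (schroedinger V)"
  proof (cases "Im z = 0")
    case True
    define x where "x = Re z"
    have zx: "z = of_real x" using True by (simp add: x_def complex_eq_iff)
    have "x > E" using n zx by (auto simp: image_iff)
    show ?thesis
    proof (rule coercive_imp_resolvent[of V v, OF V, of "-1" "x - E"])
      fix \<phi> assume \<phi>: "\<phi> \<in> l2"
      have "pairing \<phi> (\<lambda>n. - 1 * (schroedinger V \<phi> n - z * \<phi> n))
          = pairing \<phi> (\<lambda>n. of_real x * \<phi> n - schroedinger V \<phi> n)"
        by (simp add: zx)
      also have "\<dots> = x * l2_norm_sq \<phi> - energy V \<phi>"
        using \<phi> schroedinger_l2[of V v, OF V \<phi>]
        by (simp add: pairing_diff l2_scale pairing_scale pairing_self energy_eq_pairing[of V v, OF V])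
      finally show "(x - E) * l2_norm_sq \<phi> \<le> pairing \<phi> (\<lambda>n. - 1 * (schroedinger V \<phi> n - z * \<phi> n))"
        using le \<phi> by (simp add: form_le_def left_diff_distrib)
    qed (use \<open>x > E\<close> in auto)
  next
    case False
    define s where "s = sgn (Im z)"
    define \<mu> where "\<mu> = \<i> * of_real s"
    have s: "\<bar>s\<bar> = 1" "s * Im z = \<bar>Im z\<bar>"
      using False by (simp_all add: s_def sgn_if)
    have \<mu>: "cmod \<mu> = 1" using s by (simp add: \<mu>_def norm_mult)
    show ?thesis
    proof (rule coercive_imp_resolvent[of V v, OF V \<mu>, of "\<bar>Im z\<bar>"])
      fix \<phi> assume \<phi>: "\<phi> \<in> l2"
      let ?K = "1 + v + cmod z"
      have v: "v \<ge> 0" using V[of 0] by linarith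
      have K: "cmod (\<mu> * (of_real (V n) - z)) \<le> ?K" "cmod \<mu> \<le> ?K" for n
        using norm_triangle_ineq4[of "of_real (V n)" z] V[of n] \<mu> v by (simp_all add: norm_mult)
      have "pairing \<phi> (\<lambda>n. \<mu> * (schroedinger V \<phi> n - z * \<phi> n))
          = pairing \<phi> (tridiag (\<lambda>_. \<mu>) (\<lambda>_. \<mu>) (\<lambda>n. \<mu> * (of_real (V n) - z)) \<phi>)"
        by (simp add: tridiag_def schroedinger_def algebra_simps)
      also have "\<dots> = (\<Sum>\<^sub>\<infinity>n. \<phi> n \<bullet> (\<mu> * \<phi> (n + 1)) + \<phi> (n + 1) \<bullet> (\<mu> * \<phi> n)
          + \<phi> n \<bullet> ((\<mu> * (of_real (V n) - z)) * \<phi> n))"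
        by (rule pairing_tridiag[where K = ?K]) (use \<phi> K in auto)
      also have "\<dots> = (\<Sum>\<^sub>\<infinity>n. \<bar>Im z\<bar> * (cmod (\<phi> n))\<^sup>2)"
      proof (rule infsum_cong)
        fix n
        have "\<phi> n \<bullet> (\<mu> * \<phi> (n + 1)) + \<phi> (n + 1) \<bullet> (\<mu> * \<phi> n) = 0"
          by (simp add: \<mu>_def inner_complex_def algebra_simps)
        moreover have "\<phi> n \<bullet> ((\<mu> * (of_real (V n) - z)) * \<phi> n) = (s * Im z) * (cmod (\<phi> n))\<^sup>2"
          unfolding cmod_power2 by (simp add: \<mu>_def inner_complex_def algebra_simps power2_eq_square)
        ultimately show "\<phi> n \<bullet> (\<mu> * \<phi> (n + 1)) + \<phi> (n + 1) \<bullet> (\<mu> * \<phi> n)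
          + \<phi> n \<bullet> ((\<mu> * (of_real (V n) - z)) * \<phi> n) = \<bar>Im z\<bar> * (cmod (\<phi> n))\<^sup>2"
          using s by simp
      qed
      also have "\<dots> = \<bar>Im z\<bar> * l2_norm_sq \<phi>" by (simp add: infsum_cmult_right' l2_norm_sq_def)
      finally show "\<bar>Im z\<bar> * l2_norm_sq \<phi> \<le> pairing \<phi> (\<lambda>n. \<mu> * (schroedinger V \<phi> n - z * \<phi> n))" by simp
    qed (use False in auto)
  qed
  with z show False by (simp add: l2_spectrum_def)
qed

lemma energy_le: "(\<And>n. \<bar>V n\<bar> \<le> v) \<Longrightarrow> \<phi> \<in> l2 \<Longrightarrow> \<bar>energy V \<phi>\<bar> \<le> (2 + v) * l2_norm_sq \<phi>"
proof -
  assume V: "\<And>n. \<bar>V n\<bar> \<le> v" and \<phi>: "\<phi> \<in> l2"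
  let ?g = "\<lambda>n. ((cmod (\<phi> n))\<^sup>2 + (cmod (\<phi> (n + 1)))\<^sup>2) + v * (cmod (\<phi> n))\<^sup>2"
  have s: "(\<lambda>n. (cmod (\<phi> n))\<^sup>2) summable_on UNIV" "(\<lambda>n. (cmod (\<phi> (n + 1)))\<^sup>2) summable_on UNIV"
    using l2_summable[OF \<phi>] l2_summable[OF l2_shift[OF \<phi>]] by auto
  have g: "?g summable_on UNIV" by (intro summable_on_add summable_on_cmult_right s)
  have le: "norm (2 * (\<phi> n \<bullet> \<phi> (n + 1)) + V n * (cmod (\<phi> n))\<^sup>2) \<le> ?g n" for n
  proof -
    have "\<bar>V n * (cmod (\<phi> n))\<^sup>2\<bar> \<le> v * (cmod (\<phi> n))\<^sup>2"
      using V[of n] by (simp add: abs_mult mult_right_mono)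
    moreover have "\<bar>2 * (\<phi> n \<bullet> \<phi> (n + 1))\<bar> \<le> (cmod (\<phi> n))\<^sup>2 + (cmod (\<phi> (n + 1)))\<^sup>2"
      using inner_le_squares[of "\<phi> n" "\<phi> (n + 1)"] by simp
    ultimately show ?thesis unfolding real_norm_def by linarith
  qed
  have sm: "(\<lambda>n. 2 * (\<phi> n \<bullet> \<phi> (n + 1)) + V n * (cmod (\<phi> n))\<^sup>2) summable_on UNIV"
    by (rule abs_summable_summable, rule summable_on_comparison_test[OF g]) (use le in auto)
  have "norm (energy V \<phi>) \<le> infsum ?g UNIV"
    unfolding energy_def
    by (rule norm_infsum_le[OF has_sum_infsum[OF sm] has_sum_infsum[OF g]]) (use le in auto)
  also have "\<dots> = (2 + v) * l2_norm_sq \<phi>"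
    using s l2_norm_sq_shift[of \<phi> 1]
    by (simp add: infsum_add infsum_cmult_right' summable_on_add summable_on_cmult_right l2_norm_sq_def algebra_simps)
  finally show "\<bar>energy V \<phi>\<bar> \<le> (2 + v) * l2_norm_sq \<phi>" by simp
qed

text \<open>The best constant in \<open>H \<le> E\<close>. As an infimum over upper bounds, it can be compared with an energy by
  exhibiting positive solutions, without any test functions.\<close>

definition top_energy :: "(int \<Rightarrow> real) \<Rightarrow> real" where
  "top_energy V = Inf {E. form_le V E}"

lemma form_le_bounds:
  assumes V: "\<And>n. \<bar>V n\<bar> \<le> v"
  shows "form_le V (2 + v)" "form_le V E \<Longrightarrow> - (2 + v) \<le> E"
proof -
  show "form_le V (2 + v)" using energy_le[of V v, OF V] unfolding form_le_def by (meson abs_le_D1)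
  assume E: "form_le V E"
  define \<phi> :: "int \<Rightarrow> complex" where "\<phi> n = (if n = 0 then 1 else 0)" for n
  have "(\<lambda>n. (cmod (\<phi> n))\<^sup>2) summable_on UNIV \<longleftrightarrow> (\<lambda>n. (cmod (\<phi> n))\<^sup>2) summable_on {0}"
    by (rule summable_on_cong_neutral) (auto simp: \<phi>_def)
  then have \<phi>: "\<phi> \<in> l2" by (simp add: l2_def)
  have "l2_norm_sq \<phi> > 0"
    using cmod_square_le_l2_norm_sq[OF \<phi>, of 0] by (simp add: \<phi>_def)
  moreover have "- (2 + v) * l2_norm_sq \<phi> \<le> E * l2_norm_sq \<phi>"
  proof -
    have "- ((2 + v) * l2_norm_sq \<phi>) \<le> energy V \<phi>"
      using energy_le[of V v, OF V \<phi>] by linarith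
    moreover have "energy V \<phi> \<le> E * l2_norm_sq \<phi>" using E \<phi> by (simp add: form_le_def)
    ultimately show ?thesis by (simp add: algebra_simps)
  qed
  ultimately show "- (2 + v) \<le> E" by (rule mult_right_le_imp_le[rotated])
qed

lemma top_energy_least:
  assumes V: "\<And>n. \<bar>V n\<bar> \<le> v" and "form_le V E"
  shows "top_energy V \<le> E"
  unfolding top_energy_def
proof (rule cInf_lower)
  show "bdd_below {E. form_le V E}"
    by (rule bdd_belowI[of _ "- (2 + v)"]) (use form_le_bounds(2)[of V v, OF V] in blast)
qed (use assms(2) in simp)

lemma form_le_top_energy:
  assumes V: "\<And>n. \<bar>V n\<bar> \<le> v"
  shows "form_le V (top_energy V)"
  unfolding form_le_def
proof
  fix \<phi> assume \<phi>: "\<phi> \<in> l2"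
  show "energy V \<phi> \<le> top_energy V * l2_norm_sq \<phi>"
  proof (cases "l2_norm_sq \<phi> = 0")
    case True then show ?thesis using energy_le[of V v, OF V \<phi>] by simp
  next
    case False
    then have p: "l2_norm_sq \<phi> > 0" using l2_norm_sq_nonneg[of \<phi>] by simp
    have "energy V \<phi> / l2_norm_sq \<phi> \<le> top_energy V"
      unfolding top_energy_def
    proof (rule cInf_greatest)
      show "{E. form_le V E} \<noteq> {}" using form_le_bounds[of V v, OF V] by blast
      fix E assume "E \<in> {E. form_le V E}"
      then show "energy V \<phi> / l2_norm_sq \<phi> \<le> E" using p \<phi> by (simp add: form_le_def field_simps)
    qed
    then show ?thesis using p by (simp add: field_simps)
  qed
qed

text \<open>The nonnegative form of \<open>L = E\<^sup>* - H\<close> satisfies \<open>\<parallel>L \<phi>\<parallel>\<^sup>2 \<le> P \<langle>\<phi>, L \<phi>\<rangle>\<close> for some \<open>P\<close>. A bounded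
  inverse of \<open>L\<close> would thus make the form coercive, and \<open>E\<^sup>*\<close> could be lowered.\<close>

lemma top_energy_in_spectrum:
  assumes V: "\<And>n. \<bar>V n\<bar> \<le> v"
  shows "complex_of_real (top_energy V) \<in> l2_spectrum (schroedinger V)"
proof (rule ccontr)
  define E where "E = top_energy V"
  assume "\<not> ?thesis"
  then obtain C where C: "\<And>\<phi>. \<phi> \<in> l2 \<Longrightarrow>
      l2_norm \<phi> \<le> C * l2_norm (\<lambda>n. schroedinger V \<phi> n - of_real E * \<phi> n)"
    unfolding l2_spectrum_def l2_resolvent_set_def E_def by auto
  define L where "L \<phi> = (\<lambda>n. of_real E * \<phi> n - schroedinger V \<phi> n)" for \<phi>
  have L: "L \<phi> \<in> l2" if "\<phi> \<in> l2" for \<phi>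
    unfolding L_def by (intro l2_diff l2_scale schroedinger_l2[of V v, OF V] that)
  have pL: "pairing \<phi> (L \<eta>) = E * pairing \<phi> \<eta> - pairing \<phi> (schroedinger V \<eta>)"
    if "\<phi> \<in> l2" "\<eta> \<in> l2" for \<phi> \<eta>
    unfolding L_def using that by (simp add: pairing_diff l2_scale schroedinger_l2[of V v, OF V] pairing_scale)
  have sym: "pairing \<phi> (L \<eta>) = pairing \<eta> (L \<phi>)" if "\<phi> \<in> l2" "\<eta> \<in> l2" for \<phi> \<eta>
    using that by (simp add: pL schroedinger_symmetric[of V v, OF V that] pairing_commute)
  have pos: "0 \<le> pairing \<phi> (L \<phi>)" if "\<phi> \<in> l2" for \<phi>
    using form_le_top_energy[of V v, OF V] that
    by (simp add: pL pairing_self energy_eq_pairing[of V v, OF V, symmetric] form_le_def E_def)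
  define P where "P = 1 + \<bar>E\<bar> + 2 + v"
  have P: "P > 0" using V[of 0] by (simp add: P_def)
  have up: "pairing \<phi> (L \<phi>) \<le> P * l2_norm_sq \<phi>" if "\<phi> \<in> l2" for \<phi>
  proof -
    have "pairing \<phi> (L \<phi>) \<le> E * l2_norm_sq \<phi> + (2 + v) * l2_norm_sq \<phi>"
      using energy_le[of V v, OF V that] that
      by (simp add: pL pairing_self energy_eq_pairing[of V v, OF V, symmetric])
    also have "\<dots> = (E + (2 + v)) * l2_norm_sq \<phi>" by (simp add: algebra_simps)
    also have "\<dots> \<le> P * l2_norm_sq \<phi>" by (rule mult_right_mono) (auto simp: P_def l2_norm_sq_nonneg)
    finally show ?thesis .
  qed
  \<comment> \<open>The form is nonnegative at \<open>\<phi> - L \<phi> / P\<close>; the step \<open>1 / P\<close> optimizes the resulting bound.\<close>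
  have key: "l2_norm_sq (L \<phi>) / P \<le> pairing \<phi> (L \<phi>)" if \<phi>: "\<phi> \<in> l2" for \<phi>
  proof -
    define \<eta> where "\<eta> = L \<phi>"
    define s where "s = 1 / P"
    have \<eta>: "\<eta> \<in> l2" unfolding \<eta>_def by (rule L[OF \<phi>])
    define \<xi> where "\<xi> = (\<lambda>n. \<phi> n - of_real s * \<eta> n)"
    have \<xi>: "\<xi> \<in> l2" unfolding \<xi>_def by (intro l2_diff l2_scale \<phi> \<eta>)
    have expand: "pairing \<zeta> \<xi> = pairing \<zeta> \<phi> - s * pairing \<zeta> \<eta>" if "\<zeta> \<in> l2" for \<zeta>
      unfolding \<xi>_def using that \<phi> \<eta> by (simp add: pairing_diff l2_scale pairing_scale)
    have "0 \<le> pairing \<xi> (L \<xi>)" by (rule pos[OF \<xi>])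
    also have "\<dots> = pairing (L \<xi>) \<phi> - s * pairing (L \<xi>) \<eta>"
      using expand[OF L[OF \<xi>]] by (simp add: pairing_commute)
    also have "pairing (L \<xi>) \<phi> = pairing (L \<phi>) \<phi> - s * pairing (L \<phi>) \<eta>"
      using expand[OF L[OF \<phi>]] sym[OF \<phi> \<xi>] by (simp add: pairing_commute)
    also have "pairing (L \<xi>) \<eta> = pairing (L \<eta>) \<phi> - s * pairing (L \<eta>) \<eta>"
      using expand[OF L[OF \<eta>]] sym[OF \<eta> \<xi>] by (simp add: pairing_commute)
    also have "pairing (L \<eta>) \<phi> = l2_norm_sq \<eta>"
      using sym[OF \<phi> \<eta>] by (simp add: pairing_commute[of "L \<eta>"] \<eta>_def[symmetric] pairing_self)
    also have "pairing (L \<phi>) \<eta> = l2_norm_sq \<eta>" by (simp add: \<eta>_def[symmetric] pairing_self)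
    finally have "0 \<le> pairing \<phi> (L \<phi>) - 2 * s * l2_norm_sq \<eta> + s * (s * pairing \<eta> (L \<eta>))"
      by (simp add: pairing_commute algebra_simps)
    also have "s * (s * pairing \<eta> (L \<eta>)) \<le> s * (s * (P * l2_norm_sq \<eta>))"
      using up[OF \<eta>] P by (intro mult_left_mono) (auto simp: s_def)
    also have "s * (s * (P * l2_norm_sq \<eta>)) = s * l2_norm_sq \<eta>" using P by (simp add: s_def)
    finally show ?thesis by (simp add: s_def \<eta>_def)
  qed
  define c where "c = 1 / (P * (1 + C\<^sup>2))"
  have c: "c > 0" using P by (auto simp: c_def intro!: divide_pos_pos mult_pos_pos add_pos_nonneg)
  have "form_le V (E - c)" unfolding form_le_def
  proof
    fix \<phi> assume \<phi>: "\<phi> \<in> l2"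
    have "l2_norm_sq (\<lambda>n. schroedinger V \<phi> n - of_real E * \<phi> n) = l2_norm_sq (L \<phi>)"
      unfolding L_def l2_norm_sq_def by (simp add: norm_minus_commute)
    then have "sqrt (l2_norm_sq \<phi>) \<le> C * sqrt (l2_norm_sq (L \<phi>))"
      using C[OF \<phi>] by (simp add: l2_norm_eq)
    then have "(sqrt (l2_norm_sq \<phi>))\<^sup>2 \<le> (C * sqrt (l2_norm_sq (L \<phi>)))\<^sup>2"
      by (intro power_mono) (auto simp: l2_norm_sq_nonneg)
    then have "l2_norm_sq \<phi> \<le> C\<^sup>2 * l2_norm_sq (L \<phi>)" by (simp add: power_mult_distrib l2_norm_sq_nonneg)
    also have "\<dots> \<le> (1 + C\<^sup>2) * l2_norm_sq (L \<phi>)" by (rule mult_right_mono) (auto simp: l2_norm_sq_nonneg)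
    finally have "l2_norm_sq \<phi> \<le> (1 + C\<^sup>2) * l2_norm_sq (L \<phi>)" .
    then have "c * l2_norm_sq \<phi> \<le> c * ((1 + C\<^sup>2) * l2_norm_sq (L \<phi>))" using c by simp
    also have "\<dots> = l2_norm_sq (L \<phi>) / P"
    proof -
      have "1 + C\<^sup>2 \<noteq> 0" using zero_le_power2[of C] by linarith
      then show ?thesis using P by (simp add: c_def)
    qed
    also have "\<dots> \<le> pairing \<phi> (L \<phi>)" by (rule key[OF \<phi>])
    also have "\<dots> = E * l2_norm_sq \<phi> - energy V \<phi>"
      using \<phi> by (simp add: pL pairing_self energy_eq_pairing[of V v, OF V])
    finally show "energy V \<phi> \<le> (E - c) * l2_norm_sq \<phi>" by (simp add: algebra_simps)
  qed
  then have "E \<le> E - c" unfolding E_def by (rule top_energy_least[of V v, OF V])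
  with c show False by simp
qed

theorem largest_energy_top_energy:
  assumes V: "\<And>n. \<bar>V n\<bar> \<le> v"
  shows "largest_energy (schroedinger V) (top_energy V)"
  unfolding largest_energy_def
  using top_energy_in_spectrum[of V v, OF V] form_le_imp_spectrum_le[of V v, OF V form_le_top_energy[of V v, OF V]]
  by blast


section \<open>Positive solutions and the energy form\<close>

lemma infsum_symmetric_limit:
  fixes g :: "int \<Rightarrow> real"
  assumes "g summable_on UNIV"
  shows "(\<lambda>K. \<Sum>n\<in>{- int K..int K + int j}. g n) \<longlonglongrightarrow> infsum g UNIV"
proof -
  have "filterlim (\<lambda>K. {- int K..int K + int j}) (finite_subsets_at_top UNIV) sequentially"
    unfolding filterlim_finite_subsets_at_top
  proof (intro allI impI)
    fix X :: "int set" assume X: "finite X \<and> X \<subseteq> UNIV"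
    obtain M where M: "\<And>x. x \<in> X \<Longrightarrow> \<bar>x\<bar> \<le> M"
      using X finite_imageI[of X abs] by (metis Max_ge imageI)
    have "eventually (\<lambda>K. nat M \<le> K) sequentially" by (rule eventually_ge_at_top)
    then show "\<forall>\<^sub>F K in sequentially. finite {- int K..int K + int j} \<and>
        X \<subseteq> {- int K..int K + int j} \<and> {- int K..int K + int j} \<subseteq> UNIV"
      by eventually_elim (use M in fastforce)
  qed
  moreover have "(sum g \<longlongrightarrow> infsum g UNIV) (finite_subsets_at_top UNIV)"
    using has_sum_infsum[OF assms] by (simp add: has_sum_def)
  ultimately show ?thesis by (rule filterlim_compose[rotated])
qed

text \<open>The ground state representation: \<open>2 x y \<le> \<rho> x\<^sup>2 + y\<^sup>2 / \<rho>\<close> across every bond, where \<open>\<rho>\<close> is the ratio of a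
  positive solution, sums up to the form inequality. At the two ends of a finite window the missing
  terms have the right sign. Hence it is enough to have a positive solution on every window, possibly
  a different one each time, which is what an attempt at steering that never chooses \<open>0\<close> provides.\<close>

lemma form_le_if_positive_ratios:
  assumes V: "\<And>n. \<bar>V n\<bar> \<le> v"
    and ratios: "\<And>K::nat. \<exists>\<rho>. (\<forall>n\<in>{- int K - 1..int K + 1}. 0 < \<rho> n) \<and>
      (\<forall>n\<in>{- int K..int K + 1}. \<rho> n + 1 / \<rho> (n - 1) \<le> E - V n)"
  shows "form_le V E"
  unfolding form_le_def
proof
  fix \<phi> assume \<phi>: "\<phi> \<in> l2"
  define s p u where "s = (\<lambda>n. (cmod (\<phi> n))\<^sup>2)" and "p = (\<lambda>n. 2 * (\<phi> n \<bullet> \<phi> (n + 1)))"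
    and "u = (\<lambda>n. (E - V n) * s n)"
  have sn: "0 \<le> s n" for n by (simp add: s_def)
  have s: "s summable_on UNIV" unfolding s_def by (rule l2_summable[OF \<phi>])
  have p: "p summable_on UNIV" unfolding p_def
    by (intro summable_on_cmult_right inner_summable \<phi> l2_shift)
  have Vs: "(\<lambda>n. V n * s n) summable_on UNIV"
  proof (rule abs_summable_summable, rule summable_on_comparison_test)
    show "(\<lambda>n. v * s n) summable_on UNIV" by (intro summable_on_cmult_right s)
    show "norm (V n * s n) \<le> v * s n" for n
      using V[of n] sn[of n] by (simp add: abs_mult mult_right_mono)
  qed auto
  have u: "u summable_on UNIV" "infsum u UNIV = E * l2_norm_sq \<phi> - (\<Sum>\<^sub>\<infinity>n. V n * s n)"
  proof -
    have *: "u = (\<lambda>n. E * s n + - (V n * s n))" by (auto simp: u_def algebra_simps)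
    show "u summable_on UNIV" unfolding * by (intro summable_on_add summable_on_cmult_right summable_on_uminus[THEN iffD2] s Vs)
    show "infsum u UNIV = E * l2_norm_sq \<phi> - (\<Sum>\<^sub>\<infinity>n. V n * s n)" unfolding *
      using infsum_add[OF summable_on_cmult_right[OF s, of E] iffD2[OF summable_on_uminus Vs]]
      by (simp add: infsum_cmult_right' infsum_uminus l2_norm_sq_def s_def)
  qed
  have fin: "(\<Sum>n\<in>{- int K..int K}. p n) \<le> (\<Sum>n\<in>{- int K..int K + 1}. u n)" for K
  proof -
    obtain \<rho> where pos: "\<And>n. n \<in> {- int K - 1..int K + 1} \<Longrightarrow> 0 < \<rho> n"
      and eq: "\<And>n. n \<in> {- int K..int K + 1} \<Longrightarrow> \<rho> n + 1 / \<rho> (n - 1) \<le> E - V n"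
      using ratios[of K] by blast
    have nn: "0 \<le> \<rho> n * s n" "0 \<le> s (n + 1) / \<rho> n" if "n \<in> {- int K - 1..int K + 1}" for n
      using pos[OF that] sn[of n] sn[of "n + 1"] by simp_all
    have "(\<Sum>n\<in>{- int K..int K}. p n) \<le> (\<Sum>n\<in>{- int K..int K}. \<rho> n * s n + s (n + 1) / \<rho> n)"
    proof (rule sum_mono)
      fix n assume "n \<in> {- int K..int K}"
      then have r: "0 < \<rho> n" using pos by auto
      define x y where "x = cmod (\<phi> n)" and "y = cmod (\<phi> (n + 1))"
      have "p n \<le> 2 * (x * y)"
        unfolding p_def x_def y_def using norm_cauchy_schwarz[of "\<phi> n" "\<phi> (n + 1)"] by simp
      also have "\<dots> \<le> \<rho> n * x\<^sup>2 + y\<^sup>2 / \<rho> n"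
      proof -
        have "0 \<le> (\<rho> n * x - y)\<^sup>2 / \<rho> n" using r by simp
        also have "\<dots> = \<rho> n * x\<^sup>2 + y\<^sup>2 / \<rho> n - 2 * (x * y)"
          using r by (simp add: power2_diff field_simps power2_eq_square)
        finally show ?thesis by simp
      qed
      finally show "p n \<le> \<rho> n * s n + s (n + 1) / \<rho> n" by (simp add: s_def x_def y_def)
    qed
    also have "\<dots> = (\<Sum>n\<in>{- int K..int K}. \<rho> n * s n) + (\<Sum>n\<in>{- int K..int K}. s (n + 1) / \<rho> n)"
      by (rule sum.distrib)
    also have "(\<Sum>n\<in>{- int K..int K}. s (n + 1) / \<rho> n) = (\<Sum>n\<in>{- int K + 1..int K + 1}. s n / \<rho> (n - 1))"
      by (rule sum.reindex_bij_witness[of _ "\<lambda>n. n - 1" "\<lambda>n. n + 1"]) auto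
    also have "(\<Sum>n\<in>{- int K..int K}. \<rho> n * s n) \<le> (\<Sum>n\<in>{- int K..int K + 1}. \<rho> n * s n)"
    proof (rule sum_mono2)
      fix n assume "n \<in> {- int K..int K + 1} - {- int K..int K}"
      then show "0 \<le> \<rho> n * s n" by (intro nn(1)) auto
    qed auto
    also have "(\<Sum>n\<in>{- int K + 1..int K + 1}. s n / \<rho> (n - 1)) \<le> (\<Sum>n\<in>{- int K..int K + 1}. s n / \<rho> (n - 1))"
    proof (rule sum_mono2)
      fix n assume "n \<in> {- int K..int K + 1} - {- int K + 1..int K + 1}"
      then have "n - 1 \<in> {- int K - 1..int K + 1}" by auto
      from nn(2)[OF this] show "0 \<le> s n / \<rho> (n - 1)" by simp
    qed auto
    also have "(\<Sum>n\<in>{- int K..int K + 1}. \<rho> n * s n) + (\<Sum>n\<in>{- int K..int K + 1}. s n / \<rho> (n - 1))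
        = (\<Sum>n\<in>{- int K..int K + 1}. (\<rho> n + 1 / \<rho> (n - 1)) * s n)"
      by (simp add: sum.distrib[symmetric] distrib_right)
    also have "\<dots> \<le> (\<Sum>n\<in>{- int K..int K + 1}. u n)"
      unfolding u_def by (intro sum_mono mult_right_mono eq sn)
    finally show ?thesis by simp
  qed
  have "infsum p UNIV \<le> infsum u UNIV"
  proof (rule LIMSEQ_le)
    show "(\<lambda>K. \<Sum>n\<in>{- int K..int K}. p n) \<longlonglongrightarrow> infsum p UNIV"
      using infsum_symmetric_limit[OF p, of 0] by simp
    show "(\<lambda>K. \<Sum>n\<in>{- int K..int K + 1}. u n) \<longlonglongrightarrow> infsum u UNIV"
      using infsum_symmetric_limit[OF u(1), of 1] by simp
  qed (use fin in auto)
  moreover have "energy V \<phi> = infsum p UNIV + (\<Sum>\<^sub>\<infinity>n. V n * s n)"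
    unfolding energy_def p_def[symmetric] using infsum_add[OF p Vs] by (simp add: p_def s_def)
  ultimately show "energy V \<phi> \<le> E * l2_norm_sq \<phi>" using u(2) by simp
qed

section \<open>A positive, exponentially decaying Green's function\<close>

text \<open>Test the equation with the negative part \<open>N\<close> of \<open>G\<close>. The hopping terms between \<open>N\<close> and the positive
  part have a favourable sign, so \<open>N\<close> violates the form gap unless it vanishes.\<close>

lemma supersolution_nonneg:
  assumes V: "\<And>n. \<bar>V n\<bar> \<le> v" and E: "form_le V E0" "E0 < E"
    and G: "(\<lambda>n. complex_of_real (G n)) \<in> l2"
    and super: "\<And>n. 0 \<le> (E - V n) * G n - G (n + 1) - G (n - 1)"
  shows "0 \<le> G n"
proof -
  define N where "N n = max (- G n) 0" for n
  let ?N = "\<lambda>n. complex_of_real (N n)"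
  have N: "?N \<in> l2"
    by (rule l2_dominated(1)[OF l2_summable[OF G]]) (auto simp: N_def max_def)
  have "E * l2_norm_sq ?N - energy V ?N = pairing ?N (\<lambda>n. of_real E * ?N n - schroedinger V ?N n)"
    using N schroedinger_l2[of V v, OF V N]
    by (simp add: pairing_diff l2_scale pairing_scale pairing_self energy_eq_pairing[of V v, OF V])
  also have "\<dots> = (\<Sum>\<^sub>\<infinity>n. N n * ((E - V n) * N n - N (n + 1) - N (n - 1)))"
    unfolding pairing_def
    by (rule infsum_cong) (simp add: schroedinger_def inner_complex_def algebra_simps)
  also have "\<dots> = - (\<Sum>\<^sub>\<infinity>n. - (N n * ((E - V n) * N n - N (n + 1) - N (n - 1))))"
    by (simp add: infsum_uminus)
  also have "\<dots> \<le> 0"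
  proof (simp only: neg_le_0_iff_le, rule infsum_nonneg, simp only: neg_0_le_iff_le)
    fix n
    show "N n * ((E - V n) * N n - N (n + 1) - N (n - 1)) \<le> 0"
    proof (cases "G n < 0")
      case True
      then have "N n = - G n" by (simp add: N_def)
      moreover have "- G (n + 1) \<le> N (n + 1)" "- G (n - 1) \<le> N (n - 1)" by (auto simp: N_def)
      ultimately have "(E - V n) * N n - N (n + 1) - N (n - 1) \<le> 0"
        using super[of n] by simp
      then show ?thesis by (rule mult_nonneg_nonpos[rotated]) (simp add: N_def)
    qed (simp add: N_def)
  qed
  finally have "E * l2_norm_sq ?N \<le> energy V ?N" by simp
  also have "\<dots> \<le> E0 * l2_norm_sq ?N" using E(1) N by (simp add: form_le_def)
  finally have "(E - E0) * l2_norm_sq ?N \<le> 0" by (simp add: left_diff_distrib)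
  then have "l2_norm_sq ?N = 0" using E(2) l2_norm_sq_nonneg[of ?N] by (simp add: mult_le_0_iff)
  then have "?N = (\<lambda>n. 0)" using l2_norm_sq_eq_0_iff[OF N] by simp
  then have "N n = 0" by (metis of_real_eq_0_iff)
  then show ?thesis by (simp add: N_def max_def split: if_splits)
qed

text \<open>The Combes-Thomas estimate. Conjugation with the weight \<open>w n = q ^ \<bar>n - a\<bar>\<close> replaces the two hopping
  coefficients across a bond by \<open>q\<close> and \<open>1 / q\<close> in some order. Their sum exceeds \<open>2\<close> by \<open>\<kappa> = q + 1 / q - 2\<close> on
  either side of \<open>a\<close>, so the conjugated form loses at most \<open>\<kappa>\<close> and stays coercive. A solution
  of the conjugated equation in \<^term>\<open>l2\<close>, divided by \<open>w\<close>, is the decaying Green's function.\<close>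

lemma green_function:
  assumes V: "\<And>n. \<bar>V n\<bar> \<le> v" and E0: "form_le V E0"
    and q: "1 \<le> q" "q + 1 / q - 2 < E - E0"
  shows "\<exists>G C. (\<forall>n. 0 < G n) \<and> (\<forall>n. G n \<le> C / q ^ nat \<bar>n - a\<bar>) \<and>
    (\<forall>n. (E - V n) * G n - G (n + 1) - G (n - 1) = (if n = a then 1 else 0))"
proof -
  define w where "w n = q ^ nat \<bar>n - a\<bar>" for n
  have w: "1 \<le> w n" for n unfolding w_def using q(1) by simp
  then have w0: "0 < w n" "w n \<noteq> 0" for n
    using less_le_trans[OF zero_less_one w[of n]] by auto
  have step: "(w n / w (n + 1) = q \<and> w (n + 1) / w n = 1 / q) \<or>
      (w n / w (n + 1) = 1 / q \<and> w (n + 1) / w n = q)" for n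
  proof (cases "a \<le> n")
    case True
    then have "nat \<bar>n + 1 - a\<bar> = Suc (nat \<bar>n - a\<bar>)" by linarith
    then have "w (n + 1) = q * w n" by (simp only: w_def power_Suc)
    then show ?thesis using q(1) w0[of n] by simp
  next
    case False
    then have "nat \<bar>n - a\<bar> = Suc (nat \<bar>n + 1 - a\<bar>)" by linarith
    then have "w n = q * w (n + 1)" by (simp only: w_def power_Suc)
    then show ?thesis using q(1) w0[of "n + 1"] by simp
  qed
  have qb: "1 / q \<le> q"
  proof -
    have "1 / q \<le> 1" using q(1) by simp
    then show ?thesis using q(1) by linarith
  qed
  define \<kappa> where "\<kappa> = q + 1 / q - 2"
  have \<kappa>: "0 \<le> \<kappa>"
  proof -
    have "q \<noteq> 0" using q(1) by auto
    then have "(q - 1)\<^sup>2 / q = \<kappa>"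
      unfolding \<kappa>_def power2_diff diff_divide_distrib add_divide_distrib by (simp add: power2_eq_square)
    moreover have "0 \<le> (q - 1)\<^sup>2 / q" using q(1) by (intro divide_nonneg_nonneg) auto
    ultimately show ?thesis by simp
  qed
  define m where "m = E - E0 - \<kappa>"
  have m: "0 < m" using q by (simp add: m_def \<kappa>_def)
  define A B D where "A = (\<lambda>n. complex_of_real (- (w n / w (n + 1))))"
    and "B = (\<lambda>n. complex_of_real (- (w n / w (n - 1))))"
    and "D = (\<lambda>n. complex_of_real (E - V n))"
  define K where "K = q + \<bar>E\<bar> + v"
  have v: "0 \<le> v" using V[of 0] by linarith
  have bounds: "cmod (A n) \<le> K" "cmod (B n) \<le> K" "cmod (D n) \<le> K" for n
  proof -
    have le_q: "\<bar>x\<bar> \<le> q" if "x = q \<or> x = 1 / q" for x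
      using that qb q(1) by fastforce
    have "\<bar>w n / w (n + 1)\<bar> \<le> q" by (rule le_q) (use step[of n] in blast)
    moreover have "\<bar>w n / w (n - 1)\<bar> \<le> q"
      by (rule le_q) (use step[of "n - 1"] in \<open>simp only: diff_add_cancel; blast\<close>)
    ultimately show "cmod (A n) \<le> K" "cmod (B n) \<le> K"
      unfolding A_def B_def norm_of_real K_def using v by linarith+
    show "cmod (D n) \<le> K"
      unfolding D_def norm_of_real K_def using V[of n] q(1) by linarith
  qed
  have co: "m * l2_norm_sq \<phi> \<le> pairing \<phi> (tridiag A B D \<phi>)" if \<phi>: "\<phi> \<in> l2" for \<phi>
  proof -
    let ?S = "\<lambda>n. \<phi> (n + 1)"
    have S: "?S \<in> l2" by (rule l2_shift[OF \<phi>])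
    have "pairing \<phi> (tridiag A B D \<phi>) = (\<Sum>\<^sub>\<infinity>n. \<phi> n \<bullet> (A n * \<phi> (n + 1))
        + \<phi> (n + 1) \<bullet> (B (n + 1) * \<phi> n) + \<phi> n \<bullet> (D n * \<phi> n))"
      by (rule pairing_tridiag[OF \<phi> \<phi> bounds])
    \<comment> \<open>The last bracket is a difference of translates and sums to zero.\<close>
    also have "\<dots> = (\<Sum>\<^sub>\<infinity>n. \<phi> n \<bullet> (of_real E * \<phi> n - schroedinger V \<phi> n - of_real \<kappa> * ?S n)
        + (\<phi> n \<bullet> \<phi> (n - 1) - \<phi> (n + 1) \<bullet> \<phi> n))"
    proof (rule infsum_cong)
      fix n
      have "\<phi> n \<bullet> (A n * \<phi> (n + 1)) + \<phi> (n + 1) \<bullet> (B (n + 1) * \<phi> n)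
         = - (w n / w (n + 1) + w (n + 1) / w n) * (\<phi> n \<bullet> \<phi> (n + 1))"
        unfolding A_def B_def inner_of_real_mult by (simp add: inner_commute algebra_simps)
      also have "w n / w (n + 1) + w (n + 1) / w n = 2 + \<kappa>"
        using step[of n] unfolding \<kappa>_def by (elim disjE conjE) linarith+
      finally have 1: "\<phi> n \<bullet> (A n * \<phi> (n + 1)) + \<phi> (n + 1) \<bullet> (B (n + 1) * \<phi> n)
         = - (2 + \<kappa>) * (\<phi> n \<bullet> \<phi> (n + 1))" .
      show "\<phi> n \<bullet> (A n * \<phi> (n + 1)) + \<phi> (n + 1) \<bullet> (B (n + 1) * \<phi> n) + \<phi> n \<bullet> (D n * \<phi> n)
        = \<phi> n \<bullet> (of_real E * \<phi> n - schroedinger V \<phi> n - of_real \<kappa> * ?S n)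
        + (\<phi> n \<bullet> \<phi> (n - 1) - \<phi> (n + 1) \<bullet> \<phi> n)"
        unfolding 1 D_def schroedinger_def
        by (simp add: inner_of_real_mult inner_diff_right inner_add_right inner_commute algebra_simps)
    qed
    also have "\<dots> = pairing \<phi> (\<lambda>n. of_real E * \<phi> n - schroedinger V \<phi> n - of_real \<kappa> * ?S n)"
    proof -
      let ?g = "\<lambda>n. \<phi> n \<bullet> \<phi> (n - 1)"
      have g: "?g summable_on UNIV" by (intro inner_summable \<phi> l2_shift_minus)
      have g': "(\<lambda>n. \<phi> (n + 1) \<bullet> \<phi> n) summable_on UNIV" by (intro inner_summable \<phi> S)
      have "(\<Sum>\<^sub>\<infinity>n. ?g n + - (\<phi> (n + 1) \<bullet> \<phi> n)) = 0"
        using infsum_add[OF g iffD2[OF summable_on_uminus g']] infsum_shift[of ?g 1]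
        by (simp add: infsum_uminus)
      moreover have sF: "(\<lambda>n. \<phi> n \<bullet> (of_real E * \<phi> n - schroedinger V \<phi> n - of_real \<kappa> * ?S n)) summable_on UNIV"
        by (intro inner_summable \<phi> l2_diff l2_scale S schroedinger_l2[of V v, OF V])
      moreover from infsum_add[OF sF summable_on_add[OF g iffD2[OF summable_on_uminus g']]]
      have "(\<Sum>\<^sub>\<infinity>n. \<phi> n \<bullet> (of_real E * \<phi> n - schroedinger V \<phi> n - of_real \<kappa> * ?S n)
          + (?g n + - (\<phi> (n + 1) \<bullet> \<phi> n)))
        = pairing \<phi> (\<lambda>n. of_real E * \<phi> n - schroedinger V \<phi> n - of_real \<kappa> * ?S n)
          + (\<Sum>\<^sub>\<infinity>n. ?g n + - (\<phi> (n + 1) \<bullet> \<phi> n))"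
        unfolding pairing_def .
      ultimately show ?thesis by simp
    qed
    also have "\<dots> = E * l2_norm_sq \<phi> - energy V \<phi> - \<kappa> * pairing \<phi> ?S"
      using \<phi> S schroedinger_l2[of V v, OF V \<phi>]
      by (simp add: pairing_diff l2_scale l2_diff pairing_scale pairing_self energy_eq_pairing[of V v, OF V])
    finally have eq: "pairing \<phi> (tridiag A B D \<phi>) = E * l2_norm_sq \<phi> - energy V \<phi> - \<kappa> * pairing \<phi> ?S" .
    have "pairing \<phi> ?S \<le> l2_norm_sq \<phi>"
      using pairing_le[OF \<phi> S] l2_norm_sq_shift[of \<phi> 1] by simp
    then have "\<kappa> * pairing \<phi> ?S \<le> \<kappa> * l2_norm_sq \<phi>" by (rule mult_left_mono[OF _ \<kappa>])
    moreover have "energy V \<phi> \<le> E0 * l2_norm_sq \<phi>" using E0 \<phi> by (simp add: form_le_def)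
    ultimately show ?thesis unfolding eq m_def by (simp add: left_diff_distrib)
  qed
  define \<delta> :: "int \<Rightarrow> complex" where "\<delta> n = (if n = a then 1 else 0)" for n
  have "(\<lambda>n. (cmod (\<delta> n))\<^sup>2) summable_on UNIV \<longleftrightarrow> (\<lambda>n. (cmod (\<delta> n))\<^sup>2) summable_on {a}"
    by (rule summable_on_cong_neutral) (auto simp: \<delta>_def)
  then have "\<delta> \<in> l2" by (simp add: l2_def)
  then obtain \<phi> where \<phi>: "\<phi> \<in> l2" "tridiag A B D \<phi> = \<delta>"
    using coercive_tridiag_surj[OF bounds m co] by blast
  define G where "G n = Re (\<phi> n) / w n" for n
  have eq: "(E - V n) * G n - G (n + 1) - G (n - 1) = (if n = a then 1 else 0)" for n
  proof -
    have "Re (tridiag A B D \<phi> n) = w n * ((E - V n) * G n - G (n + 1) - G (n - 1))"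
      unfolding tridiag_def A_def B_def D_def G_def using w0 by (simp add: field_simps)
    then have "w n * ((E - V n) * G n - G (n + 1) - G (n - 1)) = Re (\<delta> n)"
      unfolding \<phi>(2) by simp
    moreover have "Re (\<delta> n) = (if n = a then 1 else 0)" by (simp add: \<delta>_def)
    moreover have "w a = 1" by (simp add: w_def)
    ultimately show ?thesis using w0[of n] by (cases "n = a") auto
  qed
  have Gle: "\<bar>G n\<bar> \<le> cmod (\<phi> n) / w n" for n
    unfolding G_def using w0[of n] abs_Re_le_cmod[of "\<phi> n"] by (simp add: divide_right_mono)
  have Gl2: "(\<lambda>n. complex_of_real (G n)) \<in> l2"
  proof (rule l2_dominated(1)[OF l2_summable[OF \<phi>(1)]])
    fix n
    have "cmod (\<phi> n) / w n \<le> cmod (\<phi> n)" using w0[of n] mult_left_mono[OF w[of n] norm_ge_zero[of "\<phi> n"]] by (simp add: divide_le_eq)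
    then have "\<bar>G n\<bar> \<le> cmod (\<phi> n)" using Gle[of n] by simp
    then show "(cmod (complex_of_real (G n)))\<^sup>2 \<le> (cmod (\<phi> n))\<^sup>2"
      by (intro power_mono) auto
  qed
  have "E0 < E" using m \<kappa> by (simp add: m_def)
  moreover have "0 \<le> (E - V n) * G n - G (n + 1) - G (n - 1)" for n using eq[of n] by simp
  ultimately have G0: "0 \<le> G n" for n
    by (rule supersolution_nonneg[of V v E0 E G, OF V E0 _ Gl2])
  \<comment> \<open>A zero of \<open>G\<close> would spread to its neighbours and then everywhere, but \<open>G\<close> has a source at \<open>a\<close>.\<close>
  have Gpos: "0 < G n" for n
  proof (rule ccontr)
    assume "\<not> 0 < G n"
    then have n0: "G n = 0" using G0[of n] by simp
    have nb: "G (k + 1) = 0 \<and> G (k - 1) = 0" if "G k = 0" for k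
      using eq[of k] that G0[of "k + 1"] G0[of "k - 1"] by (auto split: if_splits)
    have "G k = 0" for k
    proof (induction k rule: int_induct[where k = n])
      case base show ?case by (rule n0)
    next
      case (step1 i) then show ?case using nb by blast
    next
      case (step2 i) then show ?case using nb by blast
    qed
    then show False using eq[of a] by simp
  qed
  have "G n \<le> sqrt (l2_norm_sq \<phi>) / q ^ nat \<bar>n - a\<bar>" for n
  proof -
    have "cmod (\<phi> n) \<le> sqrt (l2_norm_sq \<phi>)"
      by (rule real_le_rsqrt[OF cmod_square_le_l2_norm_sq[OF \<phi>(1)]])
    then have "cmod (\<phi> n) / w n \<le> sqrt (l2_norm_sq \<phi>) / w n" using w0[of n] by (simp add: divide_right_mono)
    then show ?thesis using Gle[of n] unfolding w_def by linarith
  qed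
  with Gpos eq show ?thesis by blast
qed


section \<open>Steering the Riccati recursion\<close>

text \<open>The infimum \<open>x\<close> of the ratios satisfies \<open>x + 1 / x \<le> 25 / 12\<close>, and \<open>25 / 12 = 3 / 4 + 4 / 3\<close>.\<close>

lemma positive_ratio_lower_bound:
  fixes r :: "nat \<Rightarrow> real"
  assumes pos: "\<And>k. 0 < r k" and le: "\<And>k. r (Suc k) + 1 / r k \<le> 25 / 12"
  shows "3 / 4 \<le> r k"
proof -
  define x where "x = Inf (range r)"
  have bdd: "bdd_below (range r)" by (rule bdd_belowI[of _ 0]) (use pos in \<open>auto intro: less_imp_le\<close>)
  have x: "x \<le> r k" for k unfolding x_def by (rule cInf_lower[OF _ bdd]) auto
  have inv: "1 / r k \<le> 25 / 12 - x" for k using le[of k] x[of "Suc k"] by linarith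
  have "0 < 1 / r 0" using pos[of 0] by simp
  then have c: "0 < 25 / 12 - x" using inv[of 0] by (rule less_le_trans)
  have "1 / (25 / 12 - x) \<le> x"
    unfolding x_def
  proof (rule cInf_greatest)
    fix y assume "y \<in> range r"
    then obtain k where "y = r k" by blast
    then show "1 / (25 / 12 - Inf (range r)) \<le> y"
      using inv[of k] c pos[of k] unfolding x_def by (simp add: field_simps)
  qed auto
  then have "1 \<le> x * (25 / 12 - x)" using c by (simp add: field_simps)
  then have "(x - 3 / 4) * (x - 4 / 3) \<le> 0" by (simp add: algebra_simps)
  then have "3 / 4 \<le> x" by (auto simp: mult_le_0_iff)
  with x[of k] show ?thesis by linarith
qed

text \<open>Here \<open>r\<^sub>0\<close> is the ratio of the decaying background solution. The control stays above it, and within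
  distance \<open>lam\<close> of it from the first choice of \<open>0\<close> on. The recursion expands the distance to \<open>r\<^sub>0\<close> by
  a factor of at most \<open>2\<close>, so a step with \<open>lam\<close> keeps it below \<open>2 * lam - lam\<close>.\<close>

lemma greedy_control:
  fixes r\<^sub>0 U :: "nat \<Rightarrow> real"
  assumes r0: "\<And>k. 3 / 4 \<le> r\<^sub>0 k" "\<And>k. r\<^sub>0 (Suc k) = U (Suc k) - 1 / r\<^sub>0 k"
    and x: "r\<^sub>0 0 \<le> x" and lam: "0 \<le> lam"
  shows "\<exists>\<rho> \<omega>. \<rho> 0 = x \<and> (\<forall>k. \<omega> k \<in> {0, lam}) \<and> (\<forall>k. r\<^sub>0 k \<le> \<rho> k) \<and>
    (\<forall>k. \<rho> (Suc k) = U (Suc k) - \<omega> (Suc k) - 1 / \<rho> k) \<and>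
    ((\<forall>k. \<omega> (Suc k) = lam) \<or> (\<exists>k\<^sub>1. \<forall>k\<ge>k\<^sub>1. \<rho> k \<le> r\<^sub>0 k + lam))"
proof -
  define choice where "choice k y = (if r\<^sub>0 (Suc k) \<le> U (Suc k) - lam - 1 / y then lam else 0)" for k y
  define \<rho> where "\<rho> = rec_nat x (\<lambda>k y. U (Suc k) - choice k y - 1 / y)"
  define \<omega> where "\<omega> k = (case k of 0 \<Rightarrow> 0 | Suc j \<Rightarrow> choice j (\<rho> j))" for k
  have \<rho>0: "\<rho> 0 = x" by (simp add: \<rho>_def)
  have \<omega>S: "\<omega> (Suc k) = choice k (\<rho> k)" for k by (simp add: \<omega>_def)
  have \<rho>S: "\<rho> (Suc k) = U (Suc k) - \<omega> (Suc k) - 1 / \<rho> k" for k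
    by (simp add: \<rho>_def \<omega>_def)
  have \<omega>: "\<omega> k \<in> {0, lam}" for k by (cases k) (auto simp: \<omega>_def choice_def)
  have r0pos: "0 < r\<^sub>0 k" for k using r0(1)[of k] by linarith
  have lower: "r\<^sub>0 k \<le> \<rho> k" for k
  proof (induction k)
    case 0 show ?case using x \<rho>0 by simp
  next
    case (Suc k)
    have "1 / \<rho> k \<le> 1 / r\<^sub>0 k" using Suc r0pos[of k] by (intro divide_left_mono) auto
    then show ?case using r0(2)[of k] by (simp add: \<rho>S \<omega>S choice_def)
  qed
  have "\<exists>k\<^sub>1. \<forall>k\<ge>k\<^sub>1. \<rho> k \<le> r\<^sub>0 k + lam" if n: "\<not> (\<forall>k. \<omega> (Suc k) = lam)"
  proof -
    \<comment> \<open>The value \<open>0\<close> is chosen only if \<open>lam\<close> would lead below \<open>r\<^sub>0\<close>.\<close>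
    have zero_step: "\<rho> (Suc k) \<le> r\<^sub>0 (Suc k) + lam" if "\<omega> (Suc k) \<noteq> lam" for k
      using that by (simp add: \<rho>S \<omega>S choice_def split: if_splits)
    obtain j where j: "\<omega> (Suc j) \<noteq> lam" using n by blast
    have "\<rho> k \<le> r\<^sub>0 k + lam" if "Suc j \<le> k" for k
      using that
    proof (induction k rule: dec_induct)
      case base show ?case by (rule zero_step[OF j])
    next
      case (step k)
      show ?case
      proof (cases "\<omega> (Suc k) = lam")
        case True
        have "1 / r\<^sub>0 k - 1 / \<rho> k \<le> 2 * lam"
        proof -
          have rk: "r\<^sub>0 k \<noteq> 0" "\<rho> k \<noteq> 0" using r0pos[of k] lower[of k] by auto
          have "(3 / 4) * (3 / 4) \<le> r\<^sub>0 k * \<rho> k"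
            using r0(1)[of k] lower[of k] by (intro mult_mono) auto
          then have "1 / 2 * lam \<le> r\<^sub>0 k * \<rho> k * lam" using lam by (intro mult_right_mono) auto
          then have "\<rho> k - r\<^sub>0 k \<le> 2 * lam * (r\<^sub>0 k * \<rho> k)" using step.IH by (simp add: algebra_simps)
          then have "(\<rho> k - r\<^sub>0 k) / (r\<^sub>0 k * \<rho> k) \<le> 2 * lam"
            using r0pos[of k] lower[of k] by (subst pos_divide_le_eq) auto
          then show ?thesis using rk by (simp add: diff_divide_distrib)
        qed
        then show ?thesis using r0(2)[of k] True by (simp add: \<rho>S)
      qed (rule zero_step)
    qed
    then show ?thesis by blast
  qed
  with \<rho>0 \<omega> lower \<rho>S show ?thesis by blast
qed

text \<open>The solution is the Green's function up to its pole \<open>a\<close> and follows the greedy control from there. At \<open>a\<close>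
  the source term is absorbed into the next value, so that the starting ratio exceeds that of \<open>G\<close> by \<open>1 / G a\<close>.
  In the second alternative the decay rate \<open>1 + 2 * lam\<close> of \<open>G\<close> beats the relative growth rate
  \<open>1 + 4 / 3 * lam\<close>, which comes from \<open>\<rho> \<le> r\<^sub>0 + lam\<close> and \<open>r\<^sub>0 \<ge> 3 / 4\<close>.\<close>

lemma steered_solution_from:
  assumes V: "\<And>n. \<bar>V n\<bar> \<le> v" and E0: "form_le V E0"
    and E: "\<And>n. E - V n \<le> 25 / 12"
    and lam: "0 < lam" and gap: "(1 + 2 * lam) + 1 / (1 + 2 * lam) - 2 < E - E0"
  shows "\<exists>\<psi> \<omega>. (\<forall>n. 0 < \<psi> n) \<and> (\<forall>n. \<omega> n \<in> {0, lam}) \<and>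
    (\<forall>n. \<psi> (n + 1) + \<psi> (n - 1) + (V n + \<omega> n) * \<psi> n = E * \<psi> n) \<and>
    ((\<forall>n>a. \<omega> n = lam) \<or> (\<exists>C \<theta>. 0 < \<theta> \<and> \<theta> < 1 \<and> (\<forall>n. \<psi> n \<le> C * \<theta> ^ nat \<bar>n - a\<bar>)))"
proof -
  define q \<beta> where "q = 1 + 2 * lam" and "\<beta> = 1 + 4 / 3 * lam"
  have q: "1 < q" "1 < \<beta>" "\<beta> < q" using lam by (auto simp: q_def \<beta>_def)
  obtain G C where Gpos: "\<And>n. 0 < G n" and Gle: "\<And>n. G n \<le> C / q ^ nat \<bar>n - a\<bar>"
    and Geq: "\<And>n. (E - V n) * G n - G (n + 1) - G (n - 1) = (if n = a then 1 else 0)"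
    using green_function[of V v, OF V E0, of q E a] gap q unfolding q_def by auto
  have C: "0 < C" using less_le_trans[OF Gpos[of a] Gle[of a]] by simp
  define g where "g k = G (a + int k)" for k
  have gpos: "0 < g k" for k unfolding g_def by (rule Gpos)
  define r\<^sub>0 where "r\<^sub>0 k = g (Suc k) / g k" for k
  define U where "U k = E - V (a + int k)" for k
  have r0pos: "0 < r\<^sub>0 k" for k unfolding r\<^sub>0_def using gpos by simp
  have r0eq: "r\<^sub>0 (Suc k) = U (Suc k) - 1 / r\<^sub>0 k" for k
  proof -
    have "U (Suc k) * g (Suc k) - g (Suc (Suc k)) - g k = 0"
      using Geq[of "a + int (Suc k)"] by (simp add: U_def g_def add_ac)
    then show ?thesis using gpos[of k] gpos[of "Suc k"] by (simp add: r\<^sub>0_def field_simps)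
  qed
  have r0ge: "3 / 4 \<le> r\<^sub>0 k" for k
    by (rule positive_ratio_lower_bound[OF r0pos]) (use r0eq E in \<open>simp add: U_def\<close>)
  define x where "x = r\<^sub>0 0 + 1 / G a"
  have x: "r\<^sub>0 0 \<le> x" using Gpos[of a] by (simp add: x_def)
  obtain \<rho> \<omega>' where \<rho>0: "\<rho> 0 = x" and \<omega>': "\<And>k. \<omega>' k \<in> {0, lam}"
    and lower: "\<And>k. r\<^sub>0 k \<le> \<rho> k"
    and \<rho>S: "\<And>k. \<rho> (Suc k) = U (Suc k) - \<omega>' (Suc k) - 1 / \<rho> k"
    and alt: "(\<forall>k. \<omega>' (Suc k) = lam) \<or> (\<exists>k\<^sub>1. \<forall>k\<ge>k\<^sub>1. \<rho> k \<le> r\<^sub>0 k + lam)"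
    using greedy_control[of r\<^sub>0 U x lam, OF r0ge r0eq x] lam by auto
  have \<rho>pos: "0 < \<rho> k" for k using r0pos[of k] lower[of k] by linarith
  define p where "p k = G a * (\<Prod>j<k. \<rho> j)" for k
  have p0: "p 0 = G a" and pS: "p (Suc k) = \<rho> k * p k" for k by (auto simp: p_def)
  have ppos: "0 < p k" for k unfolding p_def using \<rho>pos Gpos by (auto intro!: mult_pos_pos prod_pos)
  define \<psi> where "\<psi> n = (if n \<le> a then G n else p (nat (n - a)))" for n
  define \<omega> where "\<omega> n = (if n \<le> a then 0 else \<omega>' (nat (n - a)))" for n
  have \<psi>p: "\<psi> (a + int k) = p k" for k by (auto simp: \<psi>_def p0)
  have \<psi>pos: "0 < \<psi> n" for n by (simp add: \<psi>_def Gpos ppos)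
  have eq: "\<psi> (n + 1) + \<psi> (n - 1) + (V n + \<omega> n) * \<psi> n = E * \<psi> n" for n
  proof -
    consider "n < a" | "n = a" | k where "n = a + int (Suc k)"
      by (metis zless_iff_Suc_zadd linorder_neqE)
    then show ?thesis
    proof cases
      case 1
      then show ?thesis using Geq[of n] by (simp add: \<psi>_def \<omega>_def algebra_simps)
    next
      case 2
      have "\<psi> (a + 1) = x * G a" using \<psi>p[of 1] pS[of 0] by (simp add: p0 \<rho>0)
      also have "\<dots> = G (a + 1) + 1"
        using Gpos[of a] by (simp add: x_def r\<^sub>0_def g_def field_simps)
      finally show ?thesis using Geq[of a] 2 by (simp add: \<psi>_def \<omega>_def algebra_simps)
    next
      case 3
      have "nat (n - a) = Suc k" "a < n" using 3 by linarith+
      then have "\<omega> n = \<omega>' (Suc k)" by (simp add: \<omega>_def)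
      moreover have "\<psi> n = p (Suc k)" "\<psi> (n - 1) = p k" "\<psi> (n + 1) = p (Suc (Suc k))"
        using \<psi>p[of "Suc k"] \<psi>p[of k] \<psi>p[of "Suc (Suc k)"] 3 by (simp_all add: add_ac)
      moreover have "p (Suc (Suc k)) + p k + (V n + \<omega>' (Suc k)) * p (Suc k) = E * p (Suc k)"
        unfolding pS[of "Suc k"] \<rho>S pS[of k] U_def 3
        using \<rho>pos[of k] by (simp add: field_simps)
      ultimately show ?thesis by simp
    qed
  qed
  have "\<exists>C \<theta>. 0 < \<theta> \<and> \<theta> < 1 \<and> (\<forall>n. \<psi> n \<le> C * \<theta> ^ nat \<bar>n - a\<bar>)"
    if "\<forall>k\<ge>k\<^sub>1. \<rho> k \<le> r\<^sub>0 k + lam" for k\<^sub>1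
  proof -
    define P where "P k = p k / g k" for k
    have Ppos: "0 < P k" for k unfolding P_def using ppos gpos by simp
    have PS: "P (Suc k) \<le> \<beta> * P k" if k: "k\<^sub>1 \<le> k" for k
    proof -
      have "lam \<le> 4 / 3 * lam * r\<^sub>0 k" using r0ge[of k] lam by simp
      then have "\<rho> k \<le> \<beta> * r\<^sub>0 k"
        using k \<open>\<forall>k\<ge>k\<^sub>1. \<rho> k \<le> r\<^sub>0 k + lam\<close> by (force simp: \<beta>_def algebra_simps)
      then have "\<rho> k * p k / g (Suc k) \<le> \<beta> * r\<^sub>0 k * p k / g (Suc k)"
        using ppos[of k] gpos[of "Suc k"] by (intro divide_right_mono mult_right_mono) auto
      then show ?thesis using gpos[of k] gpos[of "Suc k"] by (simp add: P_def pS r\<^sub>0_def)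
    qed
    \<comment> \<open>Before \<open>k\<^sub>1\<close> nothing is known about the growth of \<open>P = \<psi> / G\<close>; these finitely many values only enter the constant.\<close>
    define M where "M = Max (P ` {..k\<^sub>1})"
    have M: "P k \<le> M" if "k \<le> k\<^sub>1" for k unfolding M_def using that by (intro Max_ge) auto
    have M0: "0 < M" using less_le_trans[OF Ppos M] by blast
    have PM: "P k \<le> M * \<beta> ^ k" for k
    proof (induction k)
      case 0 show ?case using M[of 0] by simp
    next
      case (Suc k)
      show ?case
      proof (cases "Suc k \<le> k\<^sub>1")
        case True
        have "M * 1 \<le> M * \<beta> ^ Suc k" using q M0 by (intro mult_left_mono one_le_power) auto
        then show ?thesis using M[OF True] by linarith
      next
        case False
        then have "P (Suc k) \<le> \<beta> * P k" by (intro PS) auto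
        also have "\<dots> \<le> \<beta> * (M * \<beta> ^ k)" using q Suc by (intro mult_left_mono) auto
        finally show ?thesis by (simp add: mult_ac)
      qed
    qed
    define \<theta> where "\<theta> = \<beta> / q"
    have \<theta>: "0 < \<theta>" "\<theta> < 1" "1 / q \<le> \<theta>" using q by (auto simp: \<theta>_def divide_right_mono)
    have "\<psi> n \<le> C * max 1 M * \<theta> ^ nat \<bar>n - a\<bar>" for n
    proof (cases "n \<le> a")
      case True
      have "\<psi> n \<le> C * (1 / q) ^ nat \<bar>n - a\<bar>" using Gle[of n] True by (simp add: \<psi>_def power_one_over)
      also have "\<dots> \<le> C * \<theta> ^ nat \<bar>n - a\<bar>"
        using C q \<theta> by (intro mult_left_mono power_mono) auto
      also have "\<dots> \<le> (C * max 1 M) * \<theta> ^ nat \<bar>n - a\<bar>"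
        using C \<theta> by (intro mult_right_mono) auto
      finally show ?thesis .
    next
      case False
      then obtain k where k: "n = a + int k" by (metis zle_iff_zadd linorder_le_cases)
      have "\<psi> n = P k * g k" using gpos[of k] by (simp add: k \<psi>p P_def)
      also have "\<dots> \<le> (M * \<beta> ^ k) * (C / q ^ k)"
        using PM[of k] Gle[of n] gpos[of k] Ppos[of k] M0 q
        by (intro mult_mono) (auto simp: g_def k)
      also have "\<dots> = (C * M) * \<theta> ^ k" by (simp add: \<theta>_def power_divide)
      also have "\<dots> \<le> (C * max 1 M) * \<theta> ^ k"
        using C \<theta> by (intro mult_right_mono mult_left_mono) auto
      finally show ?thesis by (simp add: k)
    qed
    with \<theta> show ?thesis by blast
  qed
  moreover have "\<forall>n>a. \<omega> n = lam" if "\<forall>k. \<omega>' (Suc k) = lam"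
  proof (intro allI impI)
    fix n assume "n > a"
    then obtain k where "n = a + int (Suc k)" by (metis zless_iff_Suc_zadd)
    then have "nat (n - a) = Suc k" by linarith
    then show "\<omega> n = lam" using that \<open>n > a\<close> by (simp add: \<omega>_def)
  qed
  ultimately have "(\<forall>n>a. \<omega> n = lam) \<or> (\<exists>C \<theta>. 0 < \<theta> \<and> \<theta> < 1 \<and> (\<forall>n. \<psi> n \<le> C * \<theta> ^ nat \<bar>n - a\<bar>))"
    using alt by blast
  moreover have "\<omega> n \<in> {0, lam}" for n using \<omega>' by (simp add: \<omega>_def)
  ultimately show ?thesis using \<psi>pos eq by (intro exI[of _ \<psi>] exI[of _ \<omega>]) blast
qed


text \<open>Since \<open>E - lam\<close> lies below the top of the background spectrum, some window \<open>[- K - 1, K + 1]\<close> carries no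
  positive solution at that energy. A control that starts at the left end of this window is therefore
  forced to choose \<open>0\<close> eventually.\<close>

lemma steered_ground_state:
  assumes V: "\<And>n. \<bar>V n\<bar> \<le> v"
    and E: "\<And>n. E - V n \<le> 25 / 12"
    and lam: "0 < lam" "lam < 1 / 8"
    and window: "top_energy V + lam / 2 < E" "E < top_energy V + lam"
  shows "\<exists>\<psi> \<omega>. (\<forall>n. 0 < \<psi> n) \<and> (\<forall>n. \<omega> n \<in> {0, lam}) \<and>
    (\<forall>n. \<psi> (n + 1) + \<psi> (n - 1) + (V n + \<omega> n) * \<psi> n = E * \<psi> n) \<and>
    (\<exists>A \<kappa>. 0 < A \<and> 0 < \<kappa> \<and> (\<forall>n. \<psi> n \<le> A * exp (- \<kappa> * \<bar>real_of_int n\<bar>)))"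
proof -
  have "(1 + 2 * lam) + 1 / (1 + 2 * lam) - 2 = 4 * lam\<^sup>2 / (1 + 2 * lam)"
    using lam by (simp add: field_simps power2_eq_square)
  also have "\<dots> \<le> 4 * lam\<^sup>2"
    using lam by (simp add: divide_le_eq)
  also have "\<dots> < lam / 2" using lam by (simp add: power2_eq_square)
  finally have gap: "(1 + 2 * lam) + 1 / (1 + 2 * lam) - 2 < E - top_energy V" using window by linarith
  note from_site = steered_solution_from[of V v "top_energy V" E lam, OF V form_le_top_energy[of V v, OF V] E lam(1) gap]
  have "\<not> form_le V (E - lam)"
    using top_energy_least[of V v "E - lam", OF V] window by linarith
  then obtain K :: nat where K: "\<not> (\<exists>\<rho>. (\<forall>n\<in>{- int K - 1..int K + 1}. 0 < \<rho> n) \<and>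
      (\<forall>n\<in>{- int K..int K + 1}. \<rho> n + 1 / \<rho> (n - 1) \<le> E - lam - V n))"
    using form_le_if_positive_ratios[of V v "E - lam", OF V] by blast
  obtain \<psi> \<omega> where pos: "\<And>n. 0 < \<psi> n" and \<omega>: "\<And>n. \<omega> n \<in> {0, lam}"
    and eq: "\<And>n. \<psi> (n + 1) + \<psi> (n - 1) + (V n + \<omega> n) * \<psi> n = E * \<psi> n"
    and alt: "(\<forall>n>- int K - 1. \<omega> n = lam) \<or>
      (\<exists>C \<theta>. 0 < \<theta> \<and> \<theta> < 1 \<and> (\<forall>n. \<psi> n \<le> C * \<theta> ^ nat \<bar>n - (- int K - 1)\<bar>))"
    using from_site[of "- int K - 1"] by blast
  have "\<not> (\<forall>n>- int K - 1. \<omega> n = lam)"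
  proof
    assume all: "\<forall>n>- int K - 1. \<omega> n = lam"
    define \<rho> where "\<rho> n = \<psi> (n + 1) / \<psi> n" for n
    have "\<rho> n + 1 / \<rho> (n - 1) \<le> E - lam - V n" if "n \<in> {- int K..int K + 1}" for n
    proof -
      have "\<omega> n = lam" using all that by auto
      then have "\<psi> (n + 1) + \<psi> (n - 1) = (E - lam - V n) * \<psi> n"
        using eq[of n] by (simp add: algebra_simps)
      then show ?thesis using pos[of n] pos[of "n - 1"]
        by (simp add: \<rho>_def add_divide_distrib[symmetric])
    qed
    moreover have "0 < \<rho> n" for n using pos by (simp add: \<rho>_def)
    ultimately show False using K by blast
  qed
  with alt obtain C \<theta> where \<theta>: "0 < \<theta>" "\<theta> < 1"
    and le: "\<And>n. \<psi> n \<le> C * \<theta> ^ nat \<bar>n - (- int K - 1)\<bar>" by blast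
  have "0 < C * \<theta> ^ nat \<bar>0 - (- int K - 1)\<bar>" using less_le_trans[OF pos le] .
  then have C: "0 < C" using \<theta> by (simp add: zero_less_mult_iff)
  have "\<psi> n \<le> (C / \<theta> ^ (K + 1)) * exp (- (- ln \<theta>) * \<bar>real_of_int n\<bar>)" for n
  proof -
    have "exp (- (- ln \<theta>) * \<bar>real_of_int n\<bar>) = \<theta> ^ nat \<bar>n\<bar>"
    proof -
      have "\<bar>real_of_int n\<bar> = real (nat \<bar>n\<bar>)" by simp
      then show ?thesis using \<theta> by (simp only: minus_minus exp_of_nat2_mult exp_ln)
    qed
    moreover have "\<theta> ^ nat \<bar>n - (- int K - 1)\<bar> * \<theta> ^ (K + 1) \<le> \<theta> ^ nat \<bar>n\<bar>"
      unfolding power_add[symmetric] using \<theta> by (intro power_decreasing) auto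
    then have "C * \<theta> ^ nat \<bar>n - (- int K - 1)\<bar> \<le> C * (\<theta> ^ nat \<bar>n\<bar> / \<theta> ^ (K + 1))"
      using C \<theta> by (intro mult_left_mono) (auto simp: pos_le_divide_eq)
    ultimately show ?thesis using le[of n] by simp
  qed
  moreover have "0 < C / \<theta> ^ (K + 1)" "0 < - ln \<theta>" using C \<theta> by simp_all
  ultimately show ?thesis using pos \<omega> eq by blast
qed

section \<open>Ground states\<close>

lemma exp_decay_l2:
  assumes "0 < \<kappa>" "\<And>n. cmod (\<phi> n) \<le> A * exp (- \<kappa> * \<bar>real_of_int n\<bar>)"
  shows "\<phi> \<in> l2"
proof -
  define x where "x = exp (- 2 * \<kappa>)"
  have x: "0 < x" "x < 1" using assms(1) by (auto simp: x_def)
  have "(\<lambda>k. x ^ k) summable_on UNIV"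
    using x by (intro norm_summable_imp_summable_on) (simp add: summable_geometric)
  moreover have "bij_betw int UNIV {0..}" by (rule bij_betwI[where g = nat]) auto
  ultimately have N: "(\<lambda>n. x ^ nat n) summable_on {0::int..}"
    by (subst summable_on_reindex_bij_betw[of int UNIV "{0..}", symmetric]) auto
  then have M: "(\<lambda>n. x ^ nat (- n)) summable_on {..<0::int}"
  proof -
    have "(\<lambda>n. x ^ nat n) summable_on {0<..}" by (rule summable_on_subset_banach[OF N]) auto
    then show ?thesis
      by (subst summable_on_reindex_bij_betw[of uminus "{0<..}" "{..<0}", symmetric])
         (auto intro!: bij_betwI[where g = uminus])
  qed
  have "(\<lambda>n. x ^ nat \<bar>n\<bar>) summable_on ({0..} \<union> {..<0})"
  proof (rule summable_on_Un_disjoint)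
    show "(\<lambda>n. x ^ nat \<bar>n\<bar>) summable_on {0..}" using N by (rule summable_on_cong[THEN iffD1, rotated]) auto
    show "(\<lambda>n. x ^ nat \<bar>n\<bar>) summable_on {..<0}" using M by (rule summable_on_cong[THEN iffD1, rotated]) auto
  qed auto
  moreover have "{0..} \<union> {..<0::int} = UNIV" by auto
  ultimately have s: "(\<lambda>n. x ^ nat \<bar>n\<bar>) summable_on (UNIV :: int set)" by simp
  show ?thesis
  proof (rule l2_dominated(1)[OF summable_on_cmult_right[OF s, of "A\<^sup>2"]])
    fix n
    have "(cmod (\<phi> n))\<^sup>2 \<le> (A * exp (- \<kappa> * \<bar>real_of_int n\<bar>))\<^sup>2"
      by (intro power_mono assms) auto
    also have "\<dots> = A\<^sup>2 * x ^ nat \<bar>n\<bar>"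
      by (simp add: power_mult_distrib x_def exp_of_nat_mult[symmetric] exp_double[symmetric] algebra_simps)
    finally show "(cmod (\<phi> n))\<^sup>2 \<le> A\<^sup>2 * x ^ nat \<bar>n\<bar>" .
  qed
qed

text \<open>The Wronskian of \<open>\<phi>\<close> and \<open>\<psi>\<close> is constant, and it tends to \<open>0\<close> because \<open>\<phi>\<close> is bounded and \<open>\<psi>\<close> decays.\<close>

lemma positive_decaying_solution_unique:
  assumes \<psi>: "\<And>n. 0 < \<psi> n" and eq: "\<And>n. \<psi> (n + 1) + \<psi> (n - 1) + V n * \<psi> n = E * \<psi> n"
    and decay: "0 < \<kappa>" "\<And>n. \<psi> n \<le> A * exp (- \<kappa> * \<bar>real_of_int n\<bar>)"
    and \<phi>: "\<phi> \<in> l2" "schroedinger V \<phi> = (\<lambda>n. complex_of_real E * \<phi> n)"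
  shows "\<exists>k. \<forall>n. \<phi> n = k * complex_of_real (\<psi> n)"
proof -
  define W where "W n = \<phi> (n + 1) * of_real (\<psi> n) - \<phi> n * of_real (\<psi> (n + 1))" for n
  have const: "W n = W (n - 1)" for n
  proof -
    have a: "\<phi> (n + 1) = (of_real E - of_real (V n)) * \<phi> n - \<phi> (n - 1)"
      using fun_cong[OF \<phi>(2), of n] by (simp add: schroedinger_def algebra_simps)
    have b: "\<psi> (n + 1) = (E - V n) * \<psi> n - \<psi> (n - 1)"
      using eq[of n] by (simp add: algebra_simps)
    show ?thesis unfolding W_def a b by (simp add: algebra_simps)
  qed
  have W0: "W n = W 0" for n
  proof (induction n rule: int_induct[where k = 0])
    case (step1 i) then show ?case using const[of "i + 1"] by simp
  next
    case (step2 i) then show ?case using const[of i] by simp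
  qed simp
  have bound: "cmod (\<phi> n) \<le> sqrt (l2_norm_sq \<phi>)" for n
    by (rule real_le_rsqrt[OF cmod_square_le_l2_norm_sq[OF \<phi>(1)]])
  have lim: "(\<lambda>k. A * exp (- \<kappa> * real k)) \<longlonglongrightarrow> 0"
  proof -
    have "(\<lambda>k. exp (- \<kappa>) ^ k) \<longlonglongrightarrow> 0"
      using decay(1) by (intro LIMSEQ_realpow_zero) auto
    then have "(\<lambda>k. A * exp (- \<kappa>) ^ k) \<longlonglongrightarrow> A * 0" by (rule tendsto_mult_left)
    then show ?thesis by (simp only: exp_of_nat2_mult mult_zero_right)
  qed
  have \<psi>lim: "(\<lambda>k. \<psi> (int k)) \<longlonglongrightarrow> 0"
    by (rule tendsto_sandwich[OF _ _ tendsto_const lim])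
       (use \<psi> decay(2)[of "int k" for k] in \<open>auto intro!: always_eventually less_imp_le\<close>)
  have "(\<lambda>k. sqrt (l2_norm_sq \<phi>) * (\<psi> (int k) + \<psi> (int (Suc k)))) \<longlonglongrightarrow> sqrt (l2_norm_sq \<phi>) * (0 + 0)"
    by (intro tendsto_intros \<psi>lim LIMSEQ_Suc[OF \<psi>lim])
  moreover have "cmod (W 0) \<le> sqrt (l2_norm_sq \<phi>) * (\<psi> (int k) + \<psi> (int (Suc k)))" for k
  proof -
    have "cmod (W 0) = cmod (W (int k))" by (simp only: W0[of "int k"])
    also have "\<dots> \<le> cmod (\<phi> (int k + 1)) * \<psi> (int k) + cmod (\<phi> (int k)) * \<psi> (int k + 1)"
      unfolding W_def
      by (rule order_trans[OF norm_triangle_ineq4]) (use \<psi> in \<open>simp add: norm_mult less_imp_le\<close>)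
    also have "\<dots> \<le> sqrt (l2_norm_sq \<phi>) * \<psi> (int k) + sqrt (l2_norm_sq \<phi>) * \<psi> (int k + 1)"
      using \<psi> by (intro add_mono mult_right_mono bound) (auto intro: less_imp_le)
    finally show ?thesis by (simp add: distrib_left add_ac)
  qed
  ultimately have "cmod (W 0) \<le> 0" by (intro LIMSEQ_le_const) auto
  then have W: "W n = 0" for n using W0[of n] by simp
  have q: "\<phi> (n + 1) / of_real (\<psi> (n + 1)) = \<phi> n / of_real (\<psi> n)" for n
  proof -
    have "\<psi> n \<noteq> 0" "\<psi> (n + 1) \<noteq> 0" using \<psi>[of n] \<psi>[of "n + 1"] by auto
    then show ?thesis using W[of n] by (simp add: W_def frac_eq_eq)
  qed
  have "\<phi> n / of_real (\<psi> n) = \<phi> 0 / of_real (\<psi> 0)" for n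
  proof (induction n rule: int_induct[where k = 0])
    case (step1 i) then show ?case using q[of i] by simp
  next
    case (step2 i) then show ?case using q[of "i - 1"] by simp
  qed simp
  then have "\<phi> n = (\<phi> 0 / of_real (\<psi> 0)) * of_real (\<psi> n)" for n
    using \<psi>[of n] by (metis less_irrefl nonzero_eq_divide_eq of_real_eq_0_iff)
  then show ?thesis by blast
qed

lemma positive_decaying_solution_ground_state:
  assumes V: "\<And>n. \<bar>V n\<bar> \<le> v"
    and \<psi>: "\<And>n. 0 < \<psi> n" and eq: "\<And>n. \<psi> (n + 1) + \<psi> (n - 1) + V n * \<psi> n = E * \<psi> n"
    and decay: "0 < A" "0 < \<kappa>" "\<And>n. \<psi> n \<le> A * exp (- \<kappa> * \<bar>real_of_int n\<bar>)"
  shows "largest_energy (schroedinger V) E" "eigenvalue (schroedinger V) E"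
    and "eigenfunction (schroedinger V) E \<phi> \<Longrightarrow> exponentially_decaying \<phi> \<and> positive_up_to_constant \<phi>"
proof -
  let ?\<psi> = "\<lambda>n. complex_of_real (\<psi> n)"
  have l2: "?\<psi> \<in> l2"
    by (rule exp_decay_l2[OF decay(2), where A = A]) (use \<psi> decay(3) in \<open>simp add: less_imp_le\<close>)
  have sol: "schroedinger V ?\<psi> = (\<lambda>n. complex_of_real E * ?\<psi> n)"
  proof
    fix n
    have "schroedinger V ?\<psi> n = complex_of_real (\<psi> (n + 1) + \<psi> (n - 1) + V n * \<psi> n)"
      by (simp add: schroedinger_def)
    then show "schroedinger V ?\<psi> n = complex_of_real E * ?\<psi> n" by (simp add: eq)
  qed
  have nz: "?\<psi> \<noteq> (\<lambda>n. 0)"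
  proof
    assume "?\<psi> = (\<lambda>n. 0)"
    from fun_cong[OF this, of 0] show False using \<psi>[of 0] by simp
  qed
  then show "eigenvalue (schroedinger V) E"
    unfolding eigenvalue_def eigenfunction_def using l2 sol by blast
  have "form_le V E"
  proof (rule form_le_if_positive_ratios[of V v, OF V])
    define \<rho> where "\<rho> n = \<psi> (n + 1) / \<psi> n" for n
    have "\<rho> n + 1 / \<rho> (n - 1) \<le> E - V n" for n
    proof -
      have "\<psi> (n + 1) + \<psi> (n - 1) = (E - V n) * \<psi> n"
        using eq[of n] by (simp add: algebra_simps)
      then show ?thesis using \<psi>[of n] \<psi>[of "n - 1"]
        by (simp add: \<rho>_def add_divide_distrib[symmetric])
    qed
    moreover have "0 < \<rho> n" for n using \<psi> by (simp add: \<rho>_def)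
    ultimately show "\<exists>\<rho>. (\<forall>n\<in>{- int K - 1..int K + 1}. 0 < \<rho> n) \<and>
        (\<forall>n\<in>{- int K..int K + 1}. \<rho> n + 1 / \<rho> (n - 1) \<le> E - V n)" for K
      by blast
  qed
  moreover have "complex_of_real E \<in> l2_spectrum (schroedinger V)"
  proof -
    let ?R = "\<lambda>\<phi> n. schroedinger V \<phi> n - complex_of_real E * \<phi> n"
    have "?R ?\<psi> = ?R (\<lambda>n. 0)" using sol by (auto simp: fun_eq_iff schroedinger_def)
    then have "\<not> inj_on ?R l2" using l2 zero_l2 nz unfolding inj_on_def by blast
    then show ?thesis by (auto simp: l2_spectrum_def l2_resolvent_set_def bij_betw_def)
  qed
  ultimately show "largest_energy (schroedinger V) E"
    unfolding largest_energy_def using form_le_imp_spectrum_le[of V v, OF V] by blast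
  assume ef: "eigenfunction (schroedinger V) E \<phi>"
  then obtain k where k: "\<And>n. \<phi> n = k * ?\<psi> n"
    using positive_decaying_solution_unique[of \<psi> V E \<kappa> A \<phi>, OF \<psi> eq decay(2,3)]
    unfolding eigenfunction_def by blast
  have k0: "k \<noteq> 0" using ef k by (auto simp: eigenfunction_def fun_eq_iff)
  have "cmod (\<phi> n) \<le> (cmod k * A) * exp (- \<kappa> * \<bar>real_of_int n\<bar>)" for n
  proof -
    have "cmod (\<phi> n) = cmod k * \<psi> n" using \<psi>[of n] by (simp add: k norm_mult)
    also have "\<dots> \<le> cmod k * (A * exp (- \<kappa> * \<bar>real_of_int n\<bar>))" by (intro mult_left_mono decay) auto
    finally show ?thesis by (simp add: mult.assoc)
  qed
  then have "exponentially_decaying \<phi>"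
    unfolding exponentially_decaying_def using k0 decay by (intro exI[of _ "cmod k * A"] exI[of _ \<kappa>]) auto
  moreover have "positive_up_to_constant \<phi>"
    unfolding positive_up_to_constant_def using k k0 \<psi> by (intro exI[of _ k] exI[of _ \<psi>]) auto
  ultimately show "exponentially_decaying \<phi> \<and> positive_up_to_constant \<phi>" by simp
qed

section \<open>Analytic functions on the torus\<close>

text \<open>Absolute convergence at the corner \<open>x\<^sub>0 + (\<rho>, \<dots>, \<rho>)\<close> of a small cube bounds the series uniformly on the cube.\<close>

lemma real_analytic_locally_bounded:
  assumes "real_analytic (f :: real ^ 'd \<Rightarrow> real)"
  shows "\<exists>\<rho>>0. \<exists>M. \<forall>x\<in>ball x\<^sub>0 \<rho>. \<bar>f x\<bar> \<le> M"
proof -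
  obtain r and a :: "nat ^ 'd \<Rightarrow> real" where r: "0 < r" and sum: "\<And>x. x \<in> ball x\<^sub>0 r \<Longrightarrow>
      ((\<lambda>k. a k * (\<Prod>i\<in>UNIV. (x $ i - x\<^sub>0 $ i) ^ (k $ i))) has_sum f x) UNIV"
    using assms unfolding real_analytic_def by blast
  define \<rho> where "\<rho> = r / (2 * real CARD('d))"
  have card: "0 < real CARD('d)" by simp
  have \<rho>: "0 < \<rho>" "real CARD('d) * \<rho> < r" using r card by (auto simp: \<rho>_def)
  have small: "norm y < r" if "\<And>i. \<bar>y $ i\<bar> \<le> \<rho>" for y :: "real ^ 'd"
  proof -
    have "norm y \<le> (\<Sum>i\<in>UNIV. \<bar>y $ i\<bar>)" by (rule norm_le_l1_cart)
    also have "\<dots> \<le> (\<Sum>i\<in>(UNIV :: 'd set). \<rho>)" by (rule sum_mono) (rule that)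
    finally show ?thesis using \<rho> by simp
  qed
  define b where "b k = \<bar>a k\<bar> * (\<Prod>i\<in>UNIV. \<rho> ^ (k $ i))" for k
  define y :: "real ^ 'd" where "y = x\<^sub>0 + (\<chi> i. \<rho>)"
  have "norm (y - x\<^sub>0) < r" by (rule small) (use \<rho> in \<open>simp add: y_def\<close>)
  then have "y \<in> ball x\<^sub>0 r" by (simp add: dist_norm norm_minus_commute)
  from has_sum_imp_summable[OF sum[OF this]]
  have "(\<lambda>k. a k * (\<Prod>i\<in>UNIV. \<rho> ^ (k $ i))) summable_on UNIV"
    by (simp add: y_def)
  then have "(\<lambda>k. norm (a k * (\<Prod>i\<in>UNIV. \<rho> ^ (k $ i)))) summable_on UNIV"
    by (rule iffD1[OF summable_on_iff_abs_summable_on_real])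
  moreover have "norm (a k * (\<Prod>i\<in>UNIV. \<rho> ^ (k $ i))) = b k" for k
    using \<rho> by (simp add: b_def abs_mult abs_prod)
  ultimately have b: "b summable_on UNIV" by simp
  have "\<bar>f x\<bar> \<le> infsum b UNIV" if x: "x \<in> ball x\<^sub>0 \<rho>" for x
  proof -
    have xi: "\<bar>x $ i - x\<^sub>0 $ i\<bar> \<le> \<rho>" for i
    proof -
      have "\<bar>(x - x\<^sub>0) $ i\<bar> \<le> norm (x - x\<^sub>0)" by (rule component_le_norm_cart)
      also have "\<dots> < \<rho>" using x by (simp add: dist_norm norm_minus_commute)
      finally show ?thesis by simp
    qed
    have "norm (x - x\<^sub>0) < r" by (rule small) (use xi in simp)
    then have "x \<in> ball x\<^sub>0 r" by (simp add: dist_norm norm_minus_commute)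
    then have s: "((\<lambda>k. a k * (\<Prod>i\<in>UNIV. (x $ i - x\<^sub>0 $ i) ^ (k $ i))) has_sum f x) UNIV" by (rule sum)
    have "norm (f x) \<le> infsum b UNIV"
    proof (rule norm_infsum_le[OF s has_sum_infsum[OF b]])
      fix k
      have "(\<Prod>i\<in>UNIV. \<bar>(x $ i - x\<^sub>0 $ i) ^ (k $ i)\<bar>) \<le> (\<Prod>i\<in>UNIV. \<rho> ^ (k $ i))"
        by (rule prod_mono) (use xi in \<open>auto simp: power_abs intro!: power_mono\<close>)
      then show "norm (a k * (\<Prod>i\<in>UNIV. (x $ i - x\<^sub>0 $ i) ^ (k $ i))) \<le> b k"
        unfolding b_def real_norm_def abs_mult abs_prod by (rule mult_left_mono) auto
    qed
    then show ?thesis by simp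
  qed
  with \<rho>(1) show ?thesis by blast
qed

lemma real_analytic_torus_bounded:
  assumes "torus_function (f :: real ^ 'd \<Rightarrow> real)" "real_analytic f"
  shows "\<exists>F. \<forall>x. \<bar>f x\<bar> \<le> F"
proof -
  have "\<exists>\<rho> M. 0 < \<rho> \<and> (\<forall>x\<in>ball x\<^sub>0 \<rho>. \<bar>f x\<bar> \<le> M)" for x\<^sub>0
    using real_analytic_locally_bounded[OF assms(2)] by blast
  then obtain \<rho> M where \<rho>: "\<And>x\<^sub>0. 0 < \<rho> x\<^sub>0" and M: "\<And>x\<^sub>0 x. x \<in> ball x\<^sub>0 (\<rho> x\<^sub>0) \<Longrightarrow> \<bar>f x\<bar> \<le> M x\<^sub>0"
    by metis
  define Q :: "(real ^ 'd) set" where "Q = cbox 0 1"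
  have "compact Q" unfolding Q_def by (rule compact_cbox)
  moreover have "Q \<subseteq> \<Union> ((\<lambda>x. ball x (\<rho> x)) ` Q)" using \<rho> by auto
  ultimately obtain T where T: "T \<subseteq> Q" "finite T" "Q \<subseteq> \<Union> ((\<lambda>x. ball x (\<rho> x)) ` T)"
    using compactE_image[of Q Q "\<lambda>x. ball x (\<rho> x)"] by auto
  define F where "F = Max (insert 0 (M ` T))"
  have FQ: "\<bar>f x\<bar> \<le> F" if "x \<in> Q" for x
  proof -
    obtain t where t: "t \<in> T" "x \<in> ball t (\<rho> t)" using T(3) \<open>x \<in> Q\<close> by blast
    have "M t \<le> F" unfolding F_def using T(2) t(1) by (intro Max_ge) auto
    with M[OF t(2)] show ?thesis by linarith
  qed
  have "\<bar>f x\<bar> \<le> F" for x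
  proof -
    define m :: "real ^ 'd" where "m = (\<chi> i. - of_int \<lfloor>x $ i\<rfloor>)"
    have "m \<in> int_lattice" by (simp add: m_def int_lattice_def)
    then have "f x = f (x + m)" using assms(1) by (simp add: torus_function_def)
    moreover have "x + m \<in> Q"
    proof -
      have "0 \<le> x $ i - of_int \<lfloor>x $ i\<rfloor>" "x $ i - of_int \<lfloor>x $ i\<rfloor> \<le> 1" for i
        using floor_correct[of "x $ i"] by linarith+
      then show ?thesis by (simp add: Q_def m_def mem_box_cart)
    qed
    ultimately show ?thesis using FQ by simp
  qed
  then show ?thesis by blast
qed

section \<open>Prescribing the ground state energy over the quasi-periodic background\<close>

theorem theorem4p1:
  fixes \<alpha> \<theta> :: "real ^ 'd" and f :: "real ^ 'd \<Rightarrow> real"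
  assumes "diophantine \<alpha>"
    and "torus_function f" and "real_analytic f"
  shows "\<exists>c\<^sub>1>0. \<forall>c. 0 < c \<and> c < c\<^sub>1 \<longrightarrow>
    (\<exists>Ec. largest_energy (H_bg \<alpha> \<theta> f c) Ec \<and>
      (\<exists>lam\<^sub>1>0. \<forall>lam. 0 < lam \<and> lam < lam\<^sub>1 \<longrightarrow>
        (\<exists>\<epsilon>>0. \<forall>E\<in>{Ec + lam - \<epsilon><..<Ec + lam}.
          \<exists>\<omega> :: int \<Rightarrow> real. (\<forall>n. \<omega> n \<in> {0, lam}) \<and>
            largest_energy (H_pert \<alpha> \<theta> f c \<omega>) E \<and>
            eigenvalue (H_pert \<alpha> \<theta> f c \<omega>) E \<and>
            (\<forall>\<psi>. eigenfunction (H_pert \<alpha> \<theta> f c \<omega>) E \<psi> \<longrightarrow>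
              exponentially_decaying \<psi> \<and> positive_up_to_constant \<psi>))))"
proof -
  obtain F where F: "\<And>x. \<bar>f x\<bar> \<le> F" using real_analytic_torus_bounded[OF assms(2,3)] by blast
  then have F0: "0 \<le> F" using abs_ge_zero order_trans by blast
  show ?thesis
  proof (rule exI[of _ "1 / (32 * (F + 1))"], intro conjI allI impI)
    show "0 < 1 / (32 * (F + 1))" using F0 by simp
    fix c assume c: "0 < c \<and> c < 1 / (32 * (F + 1))"
    define V where "V n = c * f (\<theta> + real_of_int n *\<^sub>R \<alpha>)" for n
    have bg: "H_bg \<alpha> \<theta> f c = schroedinger V"
      and pert: "H_pert \<alpha> \<theta> f c \<omega> = schroedinger (\<lambda>n. V n + \<omega> n)" for \<omega>
      by (auto simp: H_bg_def H_pert_def V_def[abs_def])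
    \<comment> \<open>The choice of \<open>1 / 32\<close> here and of \<open>lam < 1 / 64\<close> below gives \<open>E - V n \<le> 2 + 5 / 64 \<le> 25 / 12\<close>.\<close>
    have V: "\<bar>V n\<bar> \<le> 1 / 32" for n
    proof -
      have "\<bar>V n\<bar> \<le> c * (F + 1)"
        unfolding V_def abs_mult using c F[of "\<theta> + real_of_int n *\<^sub>R \<alpha>"] by (intro mult_mono) auto
      also have "\<dots> \<le> 1 / 32" using c F0 by (simp add: field_simps)
      finally show ?thesis .
    qed
    define good where "good lam E \<longleftrightarrow> (\<exists>\<omega> :: int \<Rightarrow> real. (\<forall>n. \<omega> n \<in> {0, lam}) \<and>
        largest_energy (H_pert \<alpha> \<theta> f c \<omega>) E \<and>
        eigenvalue (H_pert \<alpha> \<theta> f c \<omega>) E \<and>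
        (\<forall>\<psi>. eigenfunction (H_pert \<alpha> \<theta> f c \<omega>) E \<psi> \<longrightarrow>
          exponentially_decaying \<psi> \<and> positive_up_to_constant \<psi>))" for lam E
    have good: "good lam E" if lam: "0 < lam" "lam < 1 / 64"
      and window: "top_energy V + lam / 2 < E" "E < top_energy V + lam" for lam E
    proof -
      have "top_energy V \<le> 2 + 1 / 32"
        by (rule top_energy_least[of V "1 / 32", OF V form_le_bounds(1)[of V "1 / 32", OF V]])
      then have EV: "E - V n \<le> 25 / 12" for n
        using window V[of n] lam by (auto simp: abs_le_iff)
      have "lam < 1 / 8" using lam by simp
      then obtain \<psi> \<omega> A \<kappa> where \<psi>: "\<And>n. 0 < \<psi> n" and \<omega>: "\<And>n. \<omega> n \<in> {0, lam}"
        and eq: "\<And>n. \<psi> (n + 1) + \<psi> (n - 1) + (V n + \<omega> n) * \<psi> n = E * \<psi> n"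
        and decay: "0 < A" "0 < \<kappa>" "\<And>n. \<psi> n \<le> A * exp (- \<kappa> * \<bar>real_of_int n\<bar>)"
        using steered_ground_state[of V "1 / 32" E lam, OF V EV lam(1) _ window] by blast
      have "\<bar>V n + \<omega> n\<bar> \<le> 1" for n using V[of n] \<omega>[of n] lam by (auto simp: abs_le_iff)
      note ground = positive_decaying_solution_ground_state
        [of "\<lambda>n. V n + \<omega> n" 1 \<psi> E A \<kappa>, OF this \<psi> eq decay]
      show ?thesis unfolding good_def pert using ground \<omega> by blast
    qed
    have "\<exists>\<epsilon>>0. \<forall>E\<in>{top_energy V + lam - \<epsilon><..<top_energy V + lam}. good lam E"
      if lam: "0 < lam \<and> lam < 1 / 64" for lam
      by (rule exI[of _ "lam / 2"]) (use lam good in auto)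
    then have "\<exists>lam\<^sub>1>0. \<forall>lam. 0 < lam \<and> lam < lam\<^sub>1 \<longrightarrow>
        (\<exists>\<epsilon>>0. \<forall>E\<in>{top_energy V + lam - \<epsilon><..<top_energy V + lam}. good lam E)"
      by (intro exI[of _ "1 / 64"]) simp
    moreover have "largest_energy (H_bg \<alpha> \<theta> f c) (top_energy V)"
      unfolding bg by (rule largest_energy_top_energy[of V "1 / 32", OF V])
    ultimately show "\<exists>Ec. largest_energy (H_bg \<alpha> \<theta> f c) Ec \<and>
      (\<exists>lam\<^sub>1>0. \<forall>lam. 0 < lam \<and> lam < lam\<^sub>1 \<longrightarrow>
        (\<exists>\<epsilon>>0. \<forall>E\<in>{Ec + lam - \<epsilon><..<Ec + lam}.
          \<exists>\<omega> :: int \<Rightarrow> real. (\<forall>n. \<omega> n \<in> {0, lam}) \<and>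
            largest_energy (H_pert \<alpha> \<theta> f c \<omega>) E \<and>
            eigenvalue (H_pert \<alpha> \<theta> f c \<omega>) E \<and>
            (\<forall>\<psi>. eigenfunction (H_pert \<alpha> \<theta> f c \<omega>) E \<psi> \<longrightarrow>
              exponentially_decaying \<psi> \<and> positive_up_to_constant \<psi>)))"
      unfolding good_def by blast
  qed
qed

end
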